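(* Let $A:D(A)\to\mathbb{E}$ be the generator of a $C_0$ semigroup $\{S_A(t)\}_{t\ge0}$ of bounded linear operators on a Banach space $\mathbb{E}$, let $T>0$ and let $F:[0,+\infty)\times\mathbb{E}\to\mathbb{E}$ be continuous, locally Lipschitz in the second variable, with sublinear growth, and such that $F(t+T,\bar u)=F(t,\bar u)$ for all $t\ge0$, $\bar u\in\mathbb{E}$. For $\bar u\in\mathbb{E}$ and $\lambda>0$ let $u(\cdot;\bar u,\lambda):[0,+\infty)\to\mathbb{E}$ be the unique solution of $$\dot u(t)=Au(t)+F(t/\lambda,u(t)),\ t>0,\qquad u(0)=\bar u.$$ Suppose that for any compact $Q_0\subset\mathbb{E}$ and any $t>0$ the set $\{u(t;\bar u,\lambda)\mid \bar u\in Q_0,\ \lambda>0\}$ is relatively compact. Then, for every $\bar u\in\mathbb{E}$, $$u(t;\bar v,\lambda)\to\widehat u(t;\bar u)\quad\text{as }\bar v\to\bar u,\ \lambda\to0^+,$$ uniformly with respect to $t$ from bounded intervals of $[0,+\infty)$, where $\widehat u(\cdot;\bar u):[0,+\infty)\to\mathbb{E}$ is the solution of $$\dot u(t)=Au(t)+\widehat F(u(t)),\ t>0,\qquad u(0)=\bar u,$$ and $\widehat F:\mathbb{E}\to\mathbb{E}$ is given by $\widehat F(\bar u):=\frac1T\int_0^T F(t,\bar u)\,dt$.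
   Context: Solutions are mild solutions: a solution of $\dot u=Au+G(t,u)$ is a continuous $u:[0,+\infty)\to\mathbb{E}$ with $u(t)=S_A(t)u(0)+\int_0^tS_A(t-s)G(s,u(s))\,ds$ for all $t>0$. Locally Lipschitz in the second variable: every $(t_0,\bar u_0)$ has a neighborhood on which $\|F(t,\bar u)-F(t,\bar v)\|\le L\|\bar u-\bar v\|$ for some constant $L$. Sublinear growth: there is $c>0$ with $\|F(t,\bar u)\|\le c(1+\|\bar u\|)$ for all $t\ge 0$, $\bar u\in\mathbb{E}$. These assumptions guarantee existence and uniqueness of global mild solutions. *)

theory Defs
  imports "HOL-Analysis.Analysis"
begin

text \<open>Only the operators \<open>S t\<close> with \<open>t \<ge> 0\<close> matter; values at negative \<open>t\<close> are unconstrained.\<close>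

definition C0_semigroup :: "(real \<Rightarrow> 'a::banach \<Rightarrow>\<^sub>L 'a) \<Rightarrow> bool" where
  "C0_semigroup S \<longleftrightarrow>
     S 0 = id_blinfun \<and>
     (\<forall>s\<ge>0. \<forall>t\<ge>0. S (s + t) = S s o\<^sub>L S t) \<and>
     (\<forall>x. ((\<lambda>t. blinfun_apply (S t) x) \<longlongrightarrow> x) (at_right 0))"

text \<open>The unbounded operator is the pair of its domain \<open>D\<close> and a function \<open>A\<close> that is relevant
  on \<open>D\<close> only.\<close>

definition is_generator ::
    "'a::banach set \<Rightarrow> ('a \<Rightarrow> 'a) \<Rightarrow> (real \<Rightarrow> 'a \<Rightarrow>\<^sub>L 'a) \<Rightarrow> bool" where
  "is_generator D A S \<longleftrightarrow>
     D = {x. \<exists>y. ((\<lambda>h. (1 / h) *\<^sub>R (blinfun_apply (S h) x - x)) \<longlongrightarrow> y) (at_right 0)} \<and>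
     (\<forall>x\<in>D. ((\<lambda>h. (1 / h) *\<^sub>R (blinfun_apply (S h) x - x)) \<longlongrightarrow> A x) (at_right 0))"

text \<open>A mild solution on the half-line of \<open>u' = A u + G(t, u)\<close>, where \<open>A\<close> generates \<open>S\<close>.
  The explicit integrability rules out the junk value of a non-existing integral.\<close>

definition mild_solution ::
    "(real \<Rightarrow> 'a::banach \<Rightarrow>\<^sub>L 'a) \<Rightarrow> (real \<Rightarrow> 'a \<Rightarrow> 'a) \<Rightarrow> (real \<Rightarrow> 'a) \<Rightarrow> bool" where
  "mild_solution S G u \<longleftrightarrow>
     continuous_on {0..} u \<and>
     (\<forall>t>0. (\<lambda>s. blinfun_apply (S (t - s)) (G s (u s))) integrable_on {0..t} \<and>
        u t = blinfun_apply (S t) (u 0)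
                + integral {0..t} (\<lambda>s. blinfun_apply (S (t - s)) (G s (u s))))"

definition sublinear_growth :: "(real \<Rightarrow> 'a::banach \<Rightarrow> 'a) \<Rightarrow> bool" where
  "sublinear_growth F \<longleftrightarrow> (\<exists>c>0. \<forall>t\<ge>0. \<forall>x. norm (F t x) \<le> c * (1 + norm x))"

definition time_average :: "real \<Rightarrow> (real \<Rightarrow> 'a::banach \<Rightarrow> 'a) \<Rightarrow> 'a \<Rightarrow> 'a" where
  "time_average T F x = (1 / T) *\<^sub>R integral {0..T} (\<lambda>t. F t x)"

end

theory Submission
  imports Defs
begin

text \<open>
  Write \<open>Fhat\<close> for the time average of \<open>F\<close>. For small \<open>\<lambda>\<close> the forcing \<open>F (t / \<lambda>)\<close> runs through a whole
  period during a time step of length \<open>h = \<lambda> * T\<close>. Over such a step a solution \<open>u\<close> hardly moves, so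
  \<open>F (s / \<lambda>) (u s)\<close> can be replaced by \<open>F (s / \<lambda>) k\<close> with \<open>k\<close> the value of \<open>u\<close> at the start of the step,
  and \<open>F (s / \<lambda>) k - Fhat k\<close> has integral exactly \<open>0\<close> over the step. Hence \<open>u\<close> satisfies the averaged
  Duhamel equation up to an error that tends to \<open>0\<close> with \<open>h\<close>, uniformly on bounded time intervals
  (\<open>duhamel_mean_zero_forcing_bound\<close>).

  Two things must be made uniform along sequences \<open>v\<^sub>n\<close> tending to \<open>x\<close> and \<open>\<lambda>\<^sub>n\<close> tending to \<open>0\<close>: how fast the
  solutions move, and how far the operators \<open>S r\<close> with \<open>0 \<le> r \<le> h\<close> are from the identity on the values
  of the forcing. Strong continuity gives the latter uniformly on compact sets only, and this is where
  the compactness assumption enters. It concerns one time at a time. The mild formula carries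
  it over to all times of \<open>{0..R}\<close> at once: between two points of a time grid a solution is the
  image under a semigroup operator of its value at the earlier grid point, up to the order of
  the mesh, so all orbits are totally bounded (\<open>orbits_in_compact\<close>) and then equicontinuous
  (\<open>orbits_equicontinuous\<close>). On the compact set \<open>K\<close> that contains the orbits, local Lipschitz continuity
  becomes Lipschitz continuity, with a constant independent of time by periodicity.

  The conclusion then follows from stability. By Gronwall's inequality, two approximate solutions of
  the averaged equation with values in one compact set are close to each other
  (\<open>approximate_mild_solutions_close\<close>). This is used three times: to see that the solutions for
  \<open>v\<^sub>n = x\<close>, \<open>\<lambda>\<^sub>n = 1 / (n + 1)\<close> form a uniform Cauchy sequence, whose limit solves the averaged
  equation; to see that this solution is unique; and to see that the solutions along any other
  sequence of parameters converge to it. Both filters in the theorem have countable bases, so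
  sequences suffice.
\<close>

section \<open>Tools from real analysis and topology\<close>

lemma nonneg_real_remainder:
  fixes t h :: real
  assumes "t \<ge> 0" "h > 0"
  obtains n :: nat and r where "t = real n * h + r" "0 \<le> r" "r < h"
proof -
  define n where "n = nat \<lfloor>t / h\<rfloor>"
  have "t / h \<ge> 0" using assms by simp
  then have "real n \<le> t / h" "t / h < real n + 1" by (simp_all add: n_def)
  then show ?thesis
    using assms by (intro that[of n "t - real n * h"]) (simp_all add: field_simps)
qed

text \<open>The function \<open>(a + b * integral {0..t} f) * exp (- b * t)\<close> has a nonpositive derivative.\<close>

lemma Gronwall_inequality:
  fixes f :: "real \<Rightarrow> real"
  assumes cont: "continuous_on {0..R} f" and b: "b \<ge> 0"
    and le: "\<And>t. t \<in> {0..R} \<Longrightarrow> f t \<le> a + b * integral {0..t} f"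
    and t: "t \<in> {0..R}"
  shows "f t \<le> a * exp (b * t)"
proof -
  define g where "g s = (a + b * integral {0..s} f) * exp (- b * s)" for s
  have g': "(g has_real_derivative (b * f s - b * (a + b * integral {0..s} f)) * exp (- b * s))
      (at s within {0..R})" if "s \<in> {0..R}" for s
    unfolding g_def
    by (auto intro!: derivative_eq_intros integral_has_real_derivative[OF cont that] simp: algebra_simps)
  have "g t \<le> g 0"
  proof (rule DERIV_nonpos_imp_decreasing_open[where a=0 and b=t])
    show "\<exists>y. (g has_real_derivative y) (at s) \<and> y \<le> 0" if "0 < s" "s < t" for s
    proof -
      have s: "s \<in> {0..R}" and "at s within {0..R} = at s"
        using that t by (auto intro!: at_within_Icc_at)
      moreover have "b * f s \<le> b * (a + b * integral {0..s} f)"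
        using le[OF s] b by (rule mult_left_mono)
      ultimately show ?thesis
        using g'[OF s] by (auto intro!: exI mult_nonpos_nonneg)
    qed
    show "continuous_on {0..t} g"
      using t by (intro continuous_on_subset[OF DERIV_continuous_on[OF g']]) auto
  qed (use t in auto)
  then have "a + b * integral {0..t} f \<le> a * exp (b * t)"
    by (simp add: g_def exp_minus field_simps)
  then show ?thesis using le[OF t] by linarith
qed

text \<open>In a complete space it is enough to find finite nets, and a net of a compact set that is close
  to \<open>X\<close> is a net of \<open>X\<close> with a larger radius.\<close>

lemma compact_closure_if_near_compact:
  fixes X :: "'a::banach set"
  assumes "\<And>e. e > 0 \<Longrightarrow> \<exists>K. compact K \<and> (\<forall>x\<in>X. \<exists>y\<in>K. dist x y < e)"
  shows "compact (closure X)"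
  unfolding compact_eq_totally_bounded
proof (intro conjI allI impI)
  show "complete (closure X)" by (simp add: complete_eq_closed)
  fix e :: real assume e: "e > 0"
  then obtain K where K: "compact K" "\<And>x. x \<in> X \<Longrightarrow> \<exists>y\<in>K. dist x y < e / 3"
    using assms[of "e / 3"] by auto
  obtain k where k: "finite k" "K \<subseteq> (\<Union>x\<in>k. ball x (e / 3))"
    using K(1) e unfolding compact_eq_totally_bounded by (meson divide_pos_pos zero_less_numeral)
  have "closure X \<subseteq> (\<Union>x\<in>k. ball x e)"
  proof
    fix z assume "z \<in> closure X"
    then obtain x where x: "x \<in> X" "dist x z < e / 3"
      using e unfolding closure_approachable by (meson divide_pos_pos zero_less_numeral)
    then obtain y where y: "y \<in> K" "dist x y < e / 3" using K by blast
    then obtain c where c: "c \<in> k" "dist c y < e / 3" using k by auto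
    have "dist c z \<le> dist c y + (dist x y + dist x z)"
      using dist_triangle[of c z y] dist_triangle[of y z x] by (simp add: dist_commute)
    then have "dist c z < e" using x y c by linarith
    then show "z \<in> (\<Union>x\<in>k. ball x e)" using c by auto
  qed
  then show "\<exists>k. finite k \<and> closure X \<subseteq> (\<Union>x\<in>k. ball x e)" using k by blast
qed

text \<open>Provides the compact sets of initial values: the points \<open>v\<^sub>n\<close> that tend to \<open>x\<close>, together with \<open>x\<close>.\<close>

lemma compact_insert_limit:
  fixes f :: "nat \<Rightarrow> 'a::metric_space"
  assumes "f \<longlonglongrightarrow> l"
  shows "compact (insert l (range f))"
proof (rule compactI)
  fix C :: "'a set set" assume op: "\<forall>U\<in>C. open U" and cov: "insert l (range f) \<subseteq> \<Union> C"
  have "\<forall>x\<in>insert l (range f). \<exists>U. U \<in> C \<and> x \<in> U"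
    using subsetD[OF cov] by (simp only: Union_iff Bex_def Ball_def) simp
  from bchoice[OF this] obtain c where "\<forall>x\<in>insert l (range f). c x \<in> C \<and> x \<in> c x" ..
  then have c: "c x \<in> C" "x \<in> c x" if "x \<in> insert l (range f)" for x
    using that by fast+
  have "\<forall>\<^sub>F n in sequentially. f n \<in> c l"
    using topological_tendstoD[OF assms, of "c l"] op c[of l] by simp
  then obtain N where N: "\<And>n. n \<ge> N \<Longrightarrow> f n \<in> c l"
    unfolding eventually_sequentially by blast
  have "insert l (range f) \<subseteq> \<Union> (insert (c l) (c ` f ` {..<N}))"
  proof
    fix x assume "x \<in> insert l (range f)"
    then consider "x = l" | n where "x = f n" by blast
    then show "x \<in> \<Union> (insert (c l) (c ` f ` {..<N}))"
    proof cases
      case 2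
      then show ?thesis using c[of "f n"] N[of n] by (cases "n < N") auto
    qed (use c[of l] in simp)
  qed
  then show "\<exists>C'\<subseteq>C. finite C' \<and> insert l (range f) \<subseteq> \<Union> C'"
    using c by (intro exI[of _ "insert (c l) (c ` f ` {..<N})"]) (simp add: image_subset_iff)
qed

section \<open>Strongly continuous semigroups\<close>

locale strongly_continuous_semigroup =
  fixes S :: "real \<Rightarrow> 'a::banach \<Rightarrow>\<^sub>L 'a"
  assumes C0: "C0_semigroup S"
begin

lemma S_0 [simp]: "S 0 = id_blinfun"
  using C0 by (simp add: C0_semigroup_def)

lemma S_add: "s \<ge> 0 \<Longrightarrow> t \<ge> 0 \<Longrightarrow> S (s + t) x = S s (S t x)"
  using C0 by (simp add: C0_semigroup_def)

lemma tendsto_S_0: "((\<lambda>t. S t x) \<longlongrightarrow> x) (at_right 0)"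
  using C0 by (simp add: C0_semigroup_def)

text \<open>A uniform boundedness argument. Strong continuity at \<open>0\<close> makes every orbit bounded near \<open>0\<close>, but
  with a bound and a time that depend on the starting point. By Baire's theorem one bound and one
  time serve for a whole ball, and by linearity for all points.\<close>

lemma norm_S_bounded_near_0:
  obtains d B where "d > 0" "B \<ge> 1" "\<And>t. t \<in> {0..d} \<Longrightarrow> norm (S t) \<le> B"
proof -
  \<comment> \<open>Points whose orbit is bounded by \<open>n\<close> up to time \<open>1 / (n + 1)\<close>: closed sets that cover the space.\<close>
  define E where "E n = (\<Inter>t\<in>{0<..1 / (real n + 1)}. {x. norm (S t x) \<le> real n})" for n :: nat
  have "closed (E n)" for n
    unfolding E_def by (intro closed_INT ballI closed_Collect_le continuous_intros)
  moreover have "\<exists>n. x \<in> E n" for x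
  proof -
    have "\<forall>\<^sub>F t in at_right 0. dist (S t x) x < 1"
      using tendsto_S_0 by (rule tendstoD) simp
    then obtain b where b: "b > 0" "\<And>t. 0 < t \<Longrightarrow> t < b \<Longrightarrow> dist (S t x) x < 1"
      unfolding eventually_at_right_field by auto
    obtain n :: nat where n: "max (1 / b) (norm x + 1) \<le> real n"
      using real_arch_simple by blast
    have "norm (S t x) \<le> real n" if "t \<in> {0<..1 / (real n + 1)}" for t
    proof -
      have "1 / (real n + 1) < b"
        using n b(1) by (simp add: divide_simps) (simp add: algebra_simps)
      then have "dist (S t x) x < 1" using that b by auto
      then have "norm (S t x - x) < 1" by (simp add: dist_norm)
      then have "norm (S t x) < norm x + 1"
        by (smt (verit) norm_triangle_sub)
      then show ?thesis using n by simp
    qed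
    then show ?thesis unfolding E_def by blast
  qed
  then have U: "\<Union> (range E) = UNIV" by auto
  ultimately have "\<exists>n. interior (E n) \<noteq> {}"
    using Baire_category_alt[of "euclidean :: 'a topology" "range E"] completely_metrizable_space_euclidean
    by (fastforce simp flip: closed_closedin)
  then obtain n x r where r: "r > 0" "ball x r \<subseteq> E n"
    by (metis all_not_in_conv mem_interior)
  have bnd: "norm (S t) \<le> 4 * real n / r" if t: "t \<in> {0<..1 / (real n + 1)}" for t
  proof (rule norm_blinfun_bound)
    fix y
    show "norm (S t y) \<le> 4 * real n / r * norm y"
    proof (cases "y = 0")
      case False
      \<comment> \<open>Scales \<open>y\<close> to length \<open>r / 2\<close>, so that \<open>x + c *\<^sub>R y\<close> stays in the ball around \<open>x\<close>.\<close>
      define c where "c = r / (2 * norm y)"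
      have c: "c > 0" using False r by (simp add: c_def)
      have "x + c *\<^sub>R y \<in> ball x r" "x \<in> ball x r"
        using False r by (simp_all add: c_def dist_norm)
      then have "x + c *\<^sub>R y \<in> E n" "x \<in> E n" using r by auto
      then have "norm (S t (x + c *\<^sub>R y)) \<le> n" "norm (S t x) \<le> n"
        using t by (auto simp: E_def)
      then have "norm (S t (x + c *\<^sub>R y) - S t x) \<le> 2 * real n"
        by (smt (verit) norm_triangle_ineq4)
      then have "c * norm (S t y) \<le> 2 * real n"
        using c by (simp add: blinfun.bilinear_simps)
      then show ?thesis using c False r by (simp add: c_def field_simps)
    qed simp
  qed (use r in auto)
  show ?thesis
  proof (rule that)
    show "0 < 1 / (real n + 1)" "1 \<le> max 1 (4 * real n / r)" by auto
    show "norm (S t) \<le> max 1 (4 * real n / r)" if "t \<in> {0..1 / (real n + 1)}" for t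
    proof (cases "t = 0")
      case True
      then show ?thesis using norm_blinfun_id_le[where 'a='a] by simp
    next
      case False
      then show ?thesis using bnd[of t] that by auto
    qed
  qed
qed

text \<open>The bound near \<open>0\<close> propagates to any bounded interval by the semigroup law.\<close>

lemma norm_S_bounded:
  obtains M where "M \<ge> 1" "\<And>t. t \<in> {0..R} \<Longrightarrow> norm (S t) \<le> M"
proof -
  obtain d B where d: "d > 0" "B \<ge> 1" and B: "\<And>t. t \<in> {0..d} \<Longrightarrow> norm (S t) \<le> B"
    using norm_S_bounded_near_0 by blast
  have pow: "\<forall>t\<in>{0..real k * d}. norm (S t) \<le> B ^ k" for k
  proof (induction k)
    case 0
    then show ?case by (simp add: norm_blinfun_id_le)
  next
    case (Suc k)
    show ?case
    proof
      fix t assume t: "t \<in> {0..real (Suc k) * d}"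
      show "norm (S t) \<le> B ^ Suc k"
      proof (cases "t \<le> d")
        case True
        then have "norm (S t) \<le> B" using B t by simp
        also have "B \<le> B ^ Suc k" using d(2) by (simp add: self_le_power del: power_Suc)
        finally show ?thesis .
      next
        case False
        have "S t = S d o\<^sub>L S (t - d)"
          using False d S_add[of d "t - d"] by (intro blinfun_eqI) simp
        then have "norm (S t) \<le> norm (S d) * norm (S (t - d))"
          by (simp add: norm_blinfun_compose)
        also have "\<dots> \<le> B * B ^ k"
          using False t d Suc.IH by (intro mult_mono B) (auto simp: algebra_simps)
        finally show ?thesis by simp
      qed
    qed
  qed
  obtain k :: nat where "R / d \<le> k" using real_arch_simple by blast
  then have "R \<le> real k * d" using d by (simp add: field_simps)
  then show ?thesis
    using pow[of k] d by (intro that[of "B ^ k"]) auto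
qed

lemma norm_S_apply_le:
  assumes "norm (S t) \<le> M" "norm x \<le> b" "0 \<le> b"
  shows "norm (S t x) \<le> M * b"
proof -
  have "norm (S t x) \<le> norm (S t) * norm x" by (rule norm_blinfun)
  also have "\<dots> \<le> M * b" using assms by (intro mult_mono) (auto intro: order_trans[OF norm_ge_zero])
  finally show ?thesis .
qed

text \<open>Strong continuity and the local bound on the operator norms together give joint continuity.\<close>

lemma continuous_on_S_pair: "continuous_on ({0..} \<times> UNIV) (\<lambda>(t, x). S t x)"
  unfolding continuous_on_iff
proof (intro ballI allI impI)
  fix p :: "real \<times> 'a" and e :: real
  assume p: "p \<in> {0..} \<times> UNIV" and e: "e > 0"
  obtain t x where p_eq: "p = (t, x)" and t: "t \<ge> 0" using p by (cases p) auto
  obtain M where M: "M \<ge> 1" "\<And>r. r \<in> {0..t + 1} \<Longrightarrow> norm (S r) \<le> M"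
    using norm_S_bounded by blast
  define e' where "e' = e / (2 * M)"
  have e': "e' > 0" using e M by (simp add: e'_def)
  have "\<forall>\<^sub>F h in at_right 0. dist (S h x) x < e'"
    using tendsto_S_0 e' by (rule tendstoD)
  then obtain b where b: "b > 0" "\<And>h. 0 < h \<Longrightarrow> h < b \<Longrightarrow> dist (S h x) x < e'"
    unfolding eventually_at_right_field by auto
  have b0: "norm (S h x - x) \<le> e'" if "0 \<le> h" "h < b" for h
  proof (cases "h = 0")
    case False
    then show ?thesis using b(2)[of h] that by (simp add: dist_norm)
  qed (use e' in simp)
  have step: "norm (S q x - S p x) \<le> M * e'" if "0 \<le> p" "p \<le> q" "q - p < b" "p \<le> t + 1" for p q
  proof -
    have "S q x - S p x = S p (S (q - p) x - x)"
      using that S_add[of p "q - p" x] by (simp add: blinfun.diff_right)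
    then show ?thesis
      using that by (auto intro!: norm_S_apply_le M b0 less_imp_le[OF e'])
  qed
  show "\<exists>d>0. \<forall>q\<in>{0..} \<times> UNIV. dist q p < d \<longrightarrow>
      dist (case q of (t, x) \<Rightarrow> S t x) (case p of (t, x) \<Rightarrow> S t x) < e"
  proof (intro exI[of _ "min 1 (min b e')"] conjI ballI impI)
    fix q :: "real \<times> 'a"
    assume q: "q \<in> {0..} \<times> UNIV" and "dist q p < min 1 (min b e')"
    then obtain t' x' where q_eq: "q = (t', x')" and t': "t' \<ge> 0"
      and d: "dist (t', x') (t, x) < min 1 (min b e')"
      using p_eq by (cases q) auto
    have dt: "\<bar>t' - t\<bar> < min 1 b"
      using d dist_fst_le[of "(t', x')" "(t, x)"] by (simp add: dist_real_def)
    have dx: "norm (x' - x) < e'"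
      using d dist_snd_le[of "(t', x')" "(t, x)"] by (simp add: dist_norm)
    have 1: "norm (S t' x' - S t' x) \<le> norm (S t') * norm (x' - x)"
      by (metis blinfun.diff_right norm_blinfun)
    also have "\<dots> \<le> M * norm (x' - x)"
      using dt t' by (intro mult_right_mono M) auto
    also have "\<dots> < M * e'" using dx M by simp
    finally have 1: "norm (S t' x' - S t' x) < M * e'" .
    have 2: "norm (S t' x - S t x) \<le> M * e'"
    proof (cases "t \<le> t'")
      case True
      then show ?thesis using step[of t t'] t dt by auto
    next
      case False
      then show ?thesis using step[of t' t] t' dt by (auto simp: norm_minus_commute)
    qed
    have "norm (S t' x' - S t x) \<le> norm (S t' x' - S t' x) + norm (S t' x - S t x)"
      by (metis diff_add_cancel add_diff_eq norm_triangle_ineq)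
    then show "dist (case q of (t, x) \<Rightarrow> S t x) (case p of (t, x) \<Rightarrow> S t x) < e"
      using 1 2 M by (simp add: e'_def dist_norm p_eq q_eq)
  qed (use b e' in auto)
qed

lemma continuous_on_S [continuous_intros]:
  assumes "continuous_on X f" "continuous_on X g" "\<And>s. s \<in> X \<Longrightarrow> f s \<ge> 0"
  shows "continuous_on X (\<lambda>s. S (f s) (g s))"
  using continuous_on_compose2[OF continuous_on_S_pair continuous_on_Pair[OF assms(1,2)]] assms(3)
  by auto

text \<open>The operators \<open>S h\<close> tend to the identity only pointwise as \<open>h\<close> tends to \<open>0\<close>; on compact sets the
  convergence is uniform, because \<open>S\<close> is jointly continuous on a compact product.\<close>

lemma S_near_identity_on_compact:
  assumes "compact K" "e > 0"
  obtains d where "d > 0" "\<And>h k. 0 \<le> h \<Longrightarrow> h \<le> d \<Longrightarrow> k \<in> K \<Longrightarrow> norm (S h k - k) \<le> e"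
proof -
  have "uniformly_continuous_on ({0..1} \<times> K) (\<lambda>(t, x). S t x)"
    by (intro compact_uniformly_continuous continuous_on_subset[OF continuous_on_S_pair]
        compact_Times assms) auto
  then obtain d where d: "d > 0" "\<And>p q. p \<in> {0..1} \<times> K \<Longrightarrow> q \<in> {0..1} \<times> K \<Longrightarrow> dist q p < d
      \<Longrightarrow> dist (case q of (t, x) \<Rightarrow> S t x) (case p of (t, x) \<Rightarrow> S t x) < e"
    using assms(2) by (rule uniformly_continuous_onE) blast
  show ?thesis
  proof (rule that[of "min 1 (d / 2)"])
    fix h k assume "0 \<le> h" "h \<le> min 1 (d / 2)" "k \<in> K"
    then show "norm (S h k - k) \<le> e"
      using d(1) d(2)[of "(0, k)" "(h, k)"] by (simp add: dist_Pair_Pair dist_norm)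
  qed (use d in simp)
qed

end

section \<open>Duhamel integrals\<close>

context strongly_continuous_semigroup
begin

definition duhamel :: "(real \<Rightarrow> 'a) \<Rightarrow> real \<Rightarrow> 'a" where
  "duhamel g t = integral {0..t} (\<lambda>s. S (t - s) (g s))"

lemma continuous_on_duhamel_integrand:
  assumes "continuous_on {a..b} g" "b \<le> t"
  shows "continuous_on {a..b} (\<lambda>s. S (t - s) (g s))"
  using assms by (intro continuous_intros) auto

lemma integrable_duhamel_integrand:
  assumes "continuous_on {a..b} g" "b \<le> t"
  shows "(\<lambda>s. S (t - s) (g s)) integrable_on {a..b}"
  using continuous_on_duhamel_integrand[OF assms] by (rule integrable_continuous_real)

lemma duhamel_0 [simp]: "duhamel g 0 = 0"
  by (simp add: duhamel_def)

text \<open>The semigroup law lets the evolution after time \<open>r\<close> forget everything but the state at time \<open>r\<close>.\<close>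

lemma duhamel_restart:
  assumes g: "continuous_on {0..t} g" and r: "0 \<le> r" "r \<le> t"
  shows "duhamel g t = S (t - r) (duhamel g r) + integral {r..t} (\<lambda>s. S (t - s) (g s))"
proof -
  have "integral {0..r} (\<lambda>s. S (t - s) (g s)) = integral {0..r} (\<lambda>s. S (t - r) (S (r - s) (g s)))"
    using r S_add[of "t - r"] by (intro integral_cong) (simp flip: S_add)
  also have "\<dots> = S (t - r) (duhamel g r)"
    unfolding duhamel_def using r
    by (intro integral_blinfun_apply integrable_duhamel_integrand continuous_on_subset[OF g]) auto
  finally show ?thesis
    using Henstock_Kurzweil_Integration.integral_combine[OF r integrable_duhamel_integrand[OF g order_refl]]
    by (simp add: duhamel_def)
qed

text \<open>Over a short time a mild solution is the free evolution of its present state, up to an error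
  proportional to the elapsed time.\<close>

lemma mild_formula_step:
  assumes g: "continuous_on {0..R} g" and C: "\<And>s. s \<in> {0..R} \<Longrightarrow> norm (g s) \<le> C"
    and M: "\<And>s. s \<in> {0..R} \<Longrightarrow> norm (S s) \<le> M"
    and u: "\<And>t. t \<in> {0..R} \<Longrightarrow> u t = S t x + duhamel g t"
    and r: "0 \<le> r" "r \<le> t" "t \<le> R"
  shows "norm (u t - S (t - r) (u r)) \<le> M * C * (t - r)"
proof -
  have g': "continuous_on {0..t} g" "continuous_on {r..t} g"
    using r by (auto intro: continuous_on_subset[OF g])
  have "S t x = S (t - r) (S r x)" using S_add[of "t - r" r x] r by simp
  then have "u t - S (t - r) (u r) = integral {r..t} (\<lambda>s. S (t - s) (g s))"
    using u[of t] u[of r] r duhamel_restart[OF g'(1) r(1,2)] by (simp add: blinfun.add_right)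
  also have "norm \<dots> \<le> M * C * (t - r)"
  proof (rule integral_bound)
    show "norm (S (t - s) (g s)) \<le> M * C" if "s \<in> {r..t}" for s
      using that r C[of s] by (intro norm_S_apply_le M C order_trans[OF norm_ge_zero C]) auto
  qed (use r continuous_on_duhamel_integrand[OF g'(2)] in auto)
  finally show ?thesis .
qed

text \<open>Compactness at each single time suffices for compactness over a whole time interval. For a grid
  of mesh \<open>h\<close>, each \<open>U i t\<close> is within \<open>M * C * h\<close> of some \<open>S r k\<close>, where \<open>k\<close> is in the compact set of one
  of the finitely many grid points and \<open>r \<in> {0..R}\<close>; these \<open>S r k\<close> form a compact set. As \<open>h\<close> is arbitrary, the orbits
  are totally bounded.\<close>

lemma orbits_in_compact:
  fixes U :: "'i \<Rightarrow> real \<Rightarrow> 'a"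
  assumes g: "\<And>i. i \<in> I \<Longrightarrow> continuous_on {0..R} (g i)"
    and C: "\<And>i s. i \<in> I \<Longrightarrow> s \<in> {0..R} \<Longrightarrow> norm (g i s) \<le> C"
    and U: "\<And>i t. i \<in> I \<Longrightarrow> t \<in> {0..R} \<Longrightarrow> U i t = S t (x i) + duhamel (g i) t"
    and K: "\<And>t. t \<in> {0..R} \<Longrightarrow> \<exists>K. compact K \<and> (\<forall>i\<in>I. U i t \<in> K)"
  shows "\<exists>K. compact K \<and> (\<forall>i\<in>I. \<forall>t\<in>{0..R}. U i t \<in> K)"
proof -
  obtain M where M: "M \<ge> 1" "\<And>t. t \<in> {0..R} \<Longrightarrow> norm (S t) \<le> M"
    using norm_S_bounded by blast
  obtain K where K: "\<And>t. t \<in> {0..R} \<Longrightarrow> compact (K t)" "\<And>i t. i \<in> I \<Longrightarrow> t \<in> {0..R} \<Longrightarrow> U i t \<in> K t"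
    using K by metis
  define X where "X = {U i t | i t. i \<in> I \<and> t \<in> {0..R}}"
  have "compact (closure X)"
  proof (rule compact_closure_if_near_compact)
    fix e :: real assume e: "e > 0"
    define b where "b = M * \<bar>C\<bar> + 1"
    have b: "b > 0" using M by (simp add: b_def add_nonneg_pos)
    define h where "h = e / b"
    have h: "h > 0" using e b by (simp add: h_def)
    \<comment> \<open>\<open>Q\<close> collects the free evolutions from the compact sets at the grid points \<open>j * h \<le> R\<close>.\<close>
    define N where "N = nat \<lfloor>R / h\<rfloor>"
    define Q where "Q = (\<Union>j\<in>{j. j \<le> N \<and> real j * h \<in> {0..R}}.
      (\<lambda>(t, x). S t x) ` ({0..R} \<times> K (real j * h)))"
    have "compact Q"
      unfolding Q_def
      by (intro compact_UN compact_continuous_image continuous_on_subset[OF continuous_on_S_pair]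
          compact_Times K) auto
    moreover have "\<exists>y\<in>Q. dist z y < e" if "z \<in> X" for z
    proof -
      obtain i t where z: "z = U i t" "i \<in> I" and t: "t \<in> {0..R}" using \<open>z \<in> X\<close> by (auto simp: X_def)
      define j where "j = nat \<lfloor>t / h\<rfloor>"
      have th: "t / h \<ge> 0" using t h by simp
      have j: "real j \<le> t / h" "t / h < real j + 1"
        using th by (simp_all add: j_def)
      then have jh: "real j * h \<le> t" "t < real j * h + h" "0 \<le> real j * h"
        using h by (simp_all add: field_simps)
      have jh': "real j * h \<in> {0..R}" "t - real j * h \<in> {0..R}"
        using jh t unfolding atLeastAtMost_iff by linarith+
      have "j \<le> N"
        unfolding j_def N_def using t h by (intro nat_mono floor_mono divide_right_mono) auto
      then have mem: "S (t - real j * h) (U i (real j * h)) \<in> Q"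
        unfolding Q_def using jh' t h K(2)[OF z(2), of "real j * h"]
        by (intro UN_I[of j] image_eqI[of _ _ "(t - real j * h, U i (real j * h))"]) auto
      have "norm (z - S (t - real j * h) (U i (real j * h))) \<le> M * C * (t - real j * h)"
        unfolding z(1) using z(2) jh t h by (intro mild_formula_step[OF g C M(2) U]) auto
      also have "\<dots> \<le> (M * \<bar>C\<bar>) * h"
        using jh M by (intro mult_mono mult_left_mono) auto
      also have "\<dots> < b * h"
        using h by (intro mult_strict_right_mono) (auto simp: b_def)
      also have "\<dots> = e" using b by (simp add: h_def)
      finally show ?thesis using mem by (auto simp: dist_norm)
    qed
    ultimately show "\<exists>K. compact K \<and> (\<forall>x\<in>X. \<exists>y\<in>K. dist x y < e)" by blast
  qed
  moreover have "U i t \<in> closure X" if "i \<in> I" "t \<in> {0..R}" for i t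
    using that by (intro subsetD[OF closure_subset]) (auto simp: X_def)
  ultimately show ?thesis by blast
qed

text \<open>From time \<open>r\<close> to time \<open>t\<close> a solution differs from \<open>S (t - r) (U i r)\<close> by \<open>O(t - r)\<close>, and on the compact
  set \<open>K\<close> the operator \<open>S (t - r)\<close> is uniformly close to the identity.\<close>

lemma orbits_equicontinuous:
  fixes U :: "'i \<Rightarrow> real \<Rightarrow> 'a"
  assumes g: "\<And>i. i \<in> I \<Longrightarrow> continuous_on {0..R} (g i)"
    and C: "\<And>i s. i \<in> I \<Longrightarrow> s \<in> {0..R} \<Longrightarrow> norm (g i s) \<le> C"
    and U: "\<And>i t. i \<in> I \<Longrightarrow> t \<in> {0..R} \<Longrightarrow> U i t = S t (x i) + duhamel (g i) t"
    and K: "compact K" "\<And>i t. i \<in> I \<Longrightarrow> t \<in> {0..R} \<Longrightarrow> U i t \<in> K"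
    and e: "e > 0"
  shows "\<exists>d>0. \<forall>i\<in>I. \<forall>r t. 0 \<le> r \<and> r \<le> t \<and> t \<le> R \<and> t - r \<le> d \<longrightarrow> norm (U i t - U i r) \<le> e"
proof -
  obtain M where M: "M \<ge> 1" "\<And>t. t \<in> {0..R} \<Longrightarrow> norm (S t) \<le> M"
    using norm_S_bounded by blast
  obtain d where d: "d > 0" "\<And>h k. 0 \<le> h \<Longrightarrow> h \<le> d \<Longrightarrow> k \<in> K \<Longrightarrow> norm (S h k - k) \<le> e / 2"
    using S_near_identity_on_compact[OF K(1), of "e / 2"] e by auto
  define b where "b = M * \<bar>C\<bar> + 1"
  have b: "b > 0" using M by (simp add: b_def add_nonneg_pos)
  show ?thesis
  proof (intro exI[of _ "min d (e / 2 / b)"] conjI ballI allI impI)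
    fix i r t
    assume i: "i \<in> I" and "0 \<le> r \<and> r \<le> t \<and> t \<le> R \<and> t - r \<le> min d (e / 2 / b)"
    then have r: "0 \<le> r" "r \<le> t" "t \<le> R" and tr: "t - r \<le> min d (e / 2 / b)" by auto
    have "norm (U i t - S (t - r) (U i r)) \<le> M * C * (t - r)"
      using r by (intro mild_formula_step[OF g[OF i] C[OF i] M(2) U[OF i]]) auto
    also have "\<dots> \<le> b * (e / 2 / b)"
      using r tr M b by (intro mult_mono) (auto simp: b_def intro!: add_increasing2 mult_left_mono)
    finally have 1: "norm (U i t - S (t - r) (U i r)) \<le> e / 2" using b by simp
    have 2: "norm (S (t - r) (U i r) - U i r) \<le> e / 2"
      using r tr by (intro d K(2)[OF i]) auto
    have "norm (U i t - U i r) \<le> norm (U i t - S (t - r) (U i r)) + norm (S (t - r) (U i r) - U i r)"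
      by (metis diff_add_cancel add_diff_eq norm_triangle_ineq)
    then show "norm (U i t - U i r) \<le> e" using 1 2 by simp
  qed (use d e b in auto)
qed

lemma norm_duhamel_diff_le:
  assumes y: "continuous_on {0..t} y" "\<And>s. s \<in> {0..t} \<Longrightarrow> y s \<in> K"
    and z: "continuous_on {0..t} z" "\<And>s. s \<in> {0..t} \<Longrightarrow> z s \<in> K"
    and f: "L-lipschitz_on K f"
    and M: "\<And>s. s \<in> {0..t} \<Longrightarrow> norm (S s) \<le> M" "M \<ge> 0"
  shows "norm (duhamel (\<lambda>s. f (y s)) t - duhamel (\<lambda>s. f (z s)) t)
    \<le> M * L * integral {0..t} (\<lambda>s. norm (y s - z s))"
proof -
  have L: "L \<ge> 0" using f by (rule lipschitz_on_nonneg)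
  have fy: "continuous_on {0..t} (\<lambda>s. f (y s))"
    by (rule continuous_on_compose2[OF lipschitz_on_continuous_on[OF f] y(1)]) (use y in auto)
  have fz: "continuous_on {0..t} (\<lambda>s. f (z s))"
    by (rule continuous_on_compose2[OF lipschitz_on_continuous_on[OF f] z(1)]) (use z in auto)
  have "duhamel (\<lambda>s. f (y s)) t - duhamel (\<lambda>s. f (z s)) t
      = integral {0..t} (\<lambda>s. S (t - s) (f (y s) - f (z s)))"
    unfolding duhamel_def
    by (simp add: blinfun.diff_right integral_diff integrable_duhamel_integrand fy fz)
  also have "norm \<dots> \<le> integral {0..t} (\<lambda>s. M * L * norm (y s - z s))"
  proof (rule integral_norm_bound_integral)
    show "(\<lambda>s. S (t - s) (f (y s) - f (z s))) integrable_on {0..t}"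
      by (intro integrable_duhamel_integrand continuous_intros fy fz) simp
    show "(\<lambda>s. M * L * norm (y s - z s)) integrable_on {0..t}"
      by (intro integrable_continuous_real continuous_intros y(1) z(1))
    show "norm (S (t - s) (f (y s) - f (z s))) \<le> M * L * norm (y s - z s)" if s: "s \<in> {0..t}" for s
    proof -
      have "norm (f (y s) - f (z s)) \<le> L * norm (y s - z s)"
        using lipschitz_onD[OF f y(2) z(2), of s s] s by (auto simp: dist_norm)
      then have "norm (S (t - s) (f (y s) - f (z s))) \<le> M * (L * norm (y s - z s))"
        using s L by (intro norm_S_apply_le M) auto
      then show ?thesis by (simp add: mult.assoc)
    qed
  qed
  also have "\<dots> = M * L * integral {0..t} (\<lambda>s. norm (y s - z s))" by simp
  finally show ?thesis .
qed

text \<open>Stability of the mild equation. The hypotheses allow errors \<open>a\<close> and \<open>b\<close>, so that the same estimate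
  serves for uniqueness (\<open>a = b = 0\<close>), for the convergence to an exact solution (\<open>b = 0\<close>) and for a
  Cauchy property.\<close>

lemma approximate_mild_solutions_close:
  assumes y: "continuous_on {0..R} y" "\<And>t. t \<in> {0..R} \<Longrightarrow> y t \<in> K"
    and z: "continuous_on {0..R} z" "\<And>t. t \<in> {0..R} \<Longrightarrow> z t \<in> K"
    and f: "L-lipschitz_on K f"
    and M: "\<And>t. t \<in> {0..R} \<Longrightarrow> norm (S t) \<le> M" "M \<ge> 0"
    and ya: "\<And>t. t \<in> {0..R} \<Longrightarrow> norm (y t - S t x - duhamel (\<lambda>s. f (y s)) t) \<le> a"
    and zb: "\<And>t. t \<in> {0..R} \<Longrightarrow> norm (z t - S t x - duhamel (\<lambda>s. f (z s)) t) \<le> b"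
    and t: "t \<in> {0..R}"
  shows "norm (y t - z t) \<le> (a + b) * exp (M * L * t)"
proof (rule Gronwall_inequality[where f = "\<lambda>t. norm (y t - z t)", OF _ _ _ t])
  show "continuous_on {0..R} (\<lambda>t. norm (y t - z t))" by (intro continuous_intros y z)
  show "M * L \<ge> 0" using lipschitz_on_nonneg[OF f] M by simp
  fix t assume t: "t \<in> {0..R}"
  have sub: "{0..t} \<subseteq> {0..R}" using t by auto
  have D: "norm (duhamel (\<lambda>s. f (y s)) t - duhamel (\<lambda>s. f (z s)) t)
      \<le> M * L * integral {0..t} (\<lambda>s. norm (y s - z s))"
    using t by (intro norm_duhamel_diff_le[where K = K] continuous_on_subset[OF y(1) sub]
        continuous_on_subset[OF z(1) sub] y(2) z(2) f M) auto
  have "y t - z t = ((y t - S t x - duhamel (\<lambda>s. f (y s)) t) - (z t - S t x - duhamel (\<lambda>s. f (z s)) t))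
      + (duhamel (\<lambda>s. f (y s)) t - duhamel (\<lambda>s. f (z s)) t)" by simp
  also have "norm \<dots> \<le> (a + b) + M * L * integral {0..t} (\<lambda>s. norm (y s - z s))"
    by (intro norm_triangle_mono D order_trans[OF norm_triangle_ineq4] add_mono ya zb t)
  finally show "norm (y t - z t) \<le> a + b + M * L * integral {0..t} (\<lambda>s. norm (y s - z s))" .
qed

text \<open>The heart of the averaging argument: a forcing with mean zero over every step of length \<open>h\<close>
  contributes little. Over the step from \<open>a\<close> to \<open>b = a + h\<close> the integrand \<open>S (t - s) (G s (y s))\<close> is compared with
  \<open>S (t - b) (G s (y a))\<close>, whose integral vanishes. The difference is at most \<open>M * (L * p + q)\<close>: \<open>L * p\<close>
  is the effect of the motion of \<open>y\<close> and \<open>q\<close> that of the semigroup. The incomplete last step costs at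
  most \<open>M * C * h\<close>.\<close>

lemma duhamel_mean_zero_forcing_bound:
  assumes h: "h > 0"
    and M: "\<And>t. t \<in> {0..R} \<Longrightarrow> norm (S t) \<le> M" "M \<ge> 0"
    and y: "continuous_on {0..R} y" "\<And>t. t \<in> {0..R} \<Longrightarrow> y t \<in> K"
    and y_osc: "\<And>r s. 0 \<le> r \<Longrightarrow> r \<le> s \<Longrightarrow> s \<le> R \<Longrightarrow> s - r \<le> h \<Longrightarrow> norm (y s - y r) \<le> p"
    and G: "continuous_on ({0..} \<times> K) (\<lambda>(s, k). G s k)"
    and G_lip: "\<And>s. s \<ge> 0 \<Longrightarrow> L-lipschitz_on K (G s)"
    and G_bound: "\<And>s k. s \<ge> 0 \<Longrightarrow> k \<in> K \<Longrightarrow> norm (G s k) \<le> C"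
    and G_mean: "\<And>a k. a \<ge> 0 \<Longrightarrow> k \<in> K \<Longrightarrow> integral {a..a + h} (\<lambda>s. G s k) = 0"
    and G_S: "\<And>r s k. 0 \<le> r \<Longrightarrow> r \<le> h \<Longrightarrow> s \<ge> 0 \<Longrightarrow> k \<in> K \<Longrightarrow> norm (S r (G s k) - G s k) \<le> q"
    and t: "t \<in> {0..R}"
  shows "norm (duhamel (\<lambda>s. G s (y s)) t) \<le> t * (M * (L * p + q)) + M * C * h"
proof -
  have L: "L \<ge> 0" using G_lip[of 0] by (auto intro: lipschitz_on_nonneg)
  have y0: "y 0 \<in> K" using y t by auto
  have C0: "C \<ge> 0" using order_trans[OF norm_ge_zero G_bound[of 0 "y 0"]] y0 by simp
  have p0: "p \<ge> 0" using order_trans[OF norm_ge_zero y_osc[of t t]] t h by simp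
  have q0: "q \<ge> 0" using order_trans[OF norm_ge_zero G_S[of 0 0 "y 0"]] y0 h by simp
  let ?f = "\<lambda>s. S (t - s) (G s (y s))"
  have Gy: "continuous_on {a..b} (\<lambda>s. G s (y s))" if "0 \<le> a" "b \<le> R" for a b
  proof -
    have 1: "continuous_on {a..b} (\<lambda>s. (s, y s))"
      using that by (intro continuous_intros continuous_on_subset[OF y(1)]) auto
    have 2: "(\<lambda>s. (s, y s)) ` {a..b} \<subseteq> {0..} \<times> K" using that y(2) by auto
    show ?thesis using continuous_on_compose2[OF G 1 2] by simp
  qed
  have Gk: "continuous_on {a..b} (\<lambda>s. G s k)" if "0 \<le> a" "k \<in> K" for a b k
  proof -
    have 1: "continuous_on {a..b} (\<lambda>s. (s, k))" by (intro continuous_intros)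
    have 2: "(\<lambda>s. (s, k)) ` {a..b} \<subseteq> {0..} \<times> K" using that by auto
    show ?thesis using continuous_on_compose2[OF G 1 2] by simp
  qed
  have int_f: "?f integrable_on {a..b}" if "0 \<le> a" "b \<le> t" for a b
    using that t by (intro integrable_duhamel_integrand Gy) auto
  have period: "norm (integral {a..a + h} ?f) \<le> h * (M * (L * p + q))" if a: "0 \<le> a" "a + h \<le> t" for a
  proof -
    let ?k = "y a" and ?b = "a + h"
    have k: "?k \<in> K" using a t h y by auto
    have "integral {a..?b} (\<lambda>s. S (t - ?b) (G s ?k)) = 0"
      using integral_blinfun_apply[OF integrable_continuous_real[OF Gk[OF a(1) k]], of ?b "S (t - ?b)"]
      by (simp add: G_mean[OF a(1) k])
    then have "integral {a..?b} ?f = integral {a..?b} (\<lambda>s. ?f s - S (t - ?b) (G s ?k))"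
      using a h t
      by (simp add: integral_diff int_f integrable_continuous_real continuous_intros Gk k)
    also have "norm \<dots> \<le> M * (L * p + q) * (?b - a)"
    proof (rule integral_bound)
      show "continuous_on {a..?b} (\<lambda>s. ?f s - S (t - ?b) (G s ?k))"
        using a h t by (intro continuous_intros Gy Gk k continuous_on_duhamel_integrand) auto
      fix s assume s: "s \<in> {a..?b}"
      have "norm (G s (y s) - G s ?k) \<le> L * norm (y s - ?k)"
        using lipschitz_onD[OF G_lip y(2) k, of s s] s a t by (auto simp: dist_norm)
      also have "\<dots> \<le> L * p"
        using s a t by (intro mult_left_mono y_osc L) auto
      finally have "norm (S (t - s) (G s (y s) - G s ?k)) \<le> M * (L * p)"
        using s a t L p0 by (intro norm_S_apply_le M) auto
      moreover have "norm (S (t - ?b) (S (?b - s) (G s ?k) - G s ?k)) \<le> M * q"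
        using s a t by (intro norm_S_apply_le M G_S q0 k) (use h in auto)
      moreover have "?f s - S (t - ?b) (G s ?k)
        = S (t - s) (G s (y s) - G s ?k) + S (t - ?b) (S (?b - s) (G s ?k) - G s ?k)"
        using S_add[of "t - ?b" "?b - s" "G s ?k"] s a by (simp add: blinfun.diff_right)
      ultimately show "norm (?f s - S (t - ?b) (G s ?k)) \<le> M * (L * p + q)"
        by (metis distrib_left norm_triangle_mono)
    qed (use h in auto)
    finally show ?thesis by (simp add: mult.commute)
  qed
  have periods: "real n * h \<le> t \<Longrightarrow> norm (integral {0..real n * h} ?f) \<le> real n * h * (M * (L * p + q))" for n
  proof (induction n)
    case (Suc n)
    have nh: "real (Suc n) * h = real n * h + h" by (simp add: algebra_simps)
    have le: "real n * h + h \<le> t" "real n * h \<le> t" "0 \<le> real n * h"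
      using Suc.prems h unfolding nh by simp_all
    have "integral {0..real n * h + h} ?f = integral {0..real n * h} ?f + integral {real n * h..real n * h + h} ?f"
      using h le by (intro Henstock_Kurzweil_Integration.integral_combine[symmetric] int_f) auto
    also have "norm \<dots> \<le> real n * h * (M * (L * p + q)) + h * (M * (L * p + q))"
      using le by (intro norm_triangle_mono Suc.IH period)
    finally show ?case unfolding nh by (simp only: distrib_right)
  qed simp
  have "t \<ge> 0" using t by simp
  then obtain n r where nr: "t = real n * h + r" "0 \<le> r" "r < h"
    using nonneg_real_remainder h by blast
  then have n: "real n * h \<le> t" "t - real n * h \<le> h" by linarith+
  have nh0: "0 \<le> real n * h" using h by simp
  have "duhamel (\<lambda>s. G s (y s)) t = integral {0..real n * h} ?f + integral {real n * h..t} ?f"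
    unfolding duhamel_def using n h by (intro Henstock_Kurzweil_Integration.integral_combine[symmetric] int_f) auto
  also have "norm \<dots> \<le> real n * h * (M * (L * p + q)) + M * C * (t - real n * h)"
  proof (intro norm_triangle_mono periods n integral_bound continuous_on_duhamel_integrand Gy)
    show "norm (?f s) \<le> M * C" if "s \<in> {real n * h..t}" for s
    proof -
      have "0 \<le> s" "s \<le> t" using that nh0 unfolding atLeastAtMost_iff by linarith+
      then show ?thesis using t by (intro norm_S_apply_le M G_bound y C0) auto
    qed
  qed (use nh0 t in auto)
  also have "\<dots> \<le> t * (M * (L * p + q)) + M * C * h"
    using n M L p0 q0 C0 by (intro add_mono mult_right_mono mult_left_mono) auto
  finally show ?thesis .
qed

text \<open>For continuous forcing the integrability clause of a mild solution is automatic and the equation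
  also holds at time \<open>0\<close>.\<close>

lemma mild_solution_iff_duhamel:
  assumes u: "continuous_on {0..} u" and G: "continuous_on {0..} (\<lambda>s. G s (u s))"
  shows "mild_solution S G u \<longleftrightarrow> (\<forall>t\<ge>0. u t = S t (u 0) + duhamel (\<lambda>s. G s (u s)) t)"
proof -
  have int: "(\<lambda>s. S (t - s) (G s (u s))) integrable_on {0..t}" for t
    by (intro integrable_duhamel_integrand continuous_on_subset[OF G]) auto
  show ?thesis
  proof
    assume "mild_solution S G u"
    then have pos: "u t = S t (u 0) + duhamel (\<lambda>s. G s (u s)) t" if "t > 0" for t
      unfolding mild_solution_def duhamel_def using that by blast
    have zero: "u 0 = S 0 (u 0) + duhamel (\<lambda>s. G s (u s)) 0" by simp
    show "\<forall>t\<ge>0. u t = S t (u 0) + duhamel (\<lambda>s. G s (u s)) t"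
      using pos zero order_le_less by blast
  next
    assume "\<forall>t\<ge>0. u t = S t (u 0) + duhamel (\<lambda>s. G s (u s)) t"
    then have "u t = S t (u 0) + duhamel (\<lambda>s. G s (u s)) t" if "t > 0" for t
      using that less_imp_le by blast
    then show "mild_solution S G u"
      using u int unfolding mild_solution_def duhamel_def by blast
  qed
qed

end

section \<open>Periodic forcing and its time average\<close>

lemma periodic_add_multiple:
  fixes f :: "real \<Rightarrow> 'a"
  assumes "\<And>t. t \<ge> 0 \<Longrightarrow> f (t + T) = f t" "T > 0" "t \<ge> 0"
  shows "f (t + real n * T) = f t"
proof (induction n)
  case (Suc n)
  then show ?case using assms(1)[of "t + real n * T"] assms(2,3) by (simp add: algebra_simps)
qed simp

lemma integral_periodic_interval:
  fixes f :: "real \<Rightarrow> 'a::banach"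
  assumes f: "continuous_on {0..} f" and T: "T > 0"
    and per: "\<And>t. t \<ge> 0 \<Longrightarrow> f (t + T) = f t" and a: "a \<ge> 0"
  shows "integral {a..a + T} f = integral {0..T} f"
proof -
  obtain n r where a_eq: "a = real n * T + r" and r: "0 \<le> r" "r < T"
    using nonneg_real_remainder[OF a T] by blast
  have int: "f integrable_on {p..q}" if "p \<ge> 0" for p q
    using that by (intro integrable_continuous_real continuous_on_subset[OF f]) auto
  have "integral {a..a + T} f = integral {r..r + T} (\<lambda>s. f (s + real n * T))"
    using integral_shift_real_ivl[of a "real n * T" "a + T" f] by (simp add: a_eq algebra_simps)
  also have "\<dots> = integral {r..r + T} f"
    using r by (intro integral_cong periodic_add_multiple per T) auto
  also have "\<dots> = integral {r..T} f + integral {T..r + T} f"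
    using r by (intro Henstock_Kurzweil_Integration.integral_combine[symmetric] int) auto
  also have "integral {T..r + T} f = integral {0..r} (\<lambda>s. f (s + T))"
    using integral_shift_real_ivl[of T T "r + T" f] by simp
  also have "\<dots> = integral {0..r} f"
    by (intro integral_cong per) auto
  also have "integral {r..T} f + integral {0..r} f = integral {0..T} f"
    using r Henstock_Kurzweil_Integration.integral_combine[of 0 r T f] int by (simp add: add.commute)
  finally show ?thesis .
qed

locale periodic_forcing =
  fixes T :: real and F :: "real \<Rightarrow> 'a::banach \<Rightarrow> 'a"
  assumes T_pos: "T > 0"
    and F_continuous: "continuous_on ({0..} \<times> UNIV) (\<lambda>(t, x). F t x)"
    and F_lipschitz: "local_lipschitz {0..} UNIV F"
    and F_growth: "sublinear_growth F"
    and F_periodic: "\<And>t x. t \<ge> 0 \<Longrightarrow> F (t + T) x = F t x"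
begin

lemma continuous_on_F:
  assumes "continuous_on X p" "continuous_on X y" "\<And>s. s \<in> X \<Longrightarrow> p s \<ge> 0"
  shows "continuous_on X (\<lambda>s. F (p s) (y s))"
  using continuous_on_compose2[OF F_continuous continuous_on_Pair[OF assms(1,2)]] assms(3)
  by auto

text \<open>Periodicity reduces all uniformity in \<open>t \<ge> 0\<close> to the compact interval \<open>{0..T}\<close>.\<close>

lemma F_value_in_period:
  assumes "t \<ge> 0"
  obtains r where "r \<in> {0..T}" "F t = F r"
proof -
  obtain n r where t: "t = real n * T + r" and r: "0 \<le> r" "r < T"
    using nonneg_real_remainder[OF assms T_pos] by blast
  have "F (r + real n * T) = F r"
    using r(1) T_pos F_periodic by (intro periodic_add_multiple ext) auto
  then show ?thesis using r by (intro that[of r]) (auto simp: t add.commute)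
qed

lemma F_lipschitz_on_compact:
  assumes "compact K"
  obtains L where "\<And>t. t \<ge> 0 \<Longrightarrow> L-lipschitz_on K (F t)"
proof -
  have ll: "local_lipschitz {0..T} K F"
    by (rule local_lipschitz_subset[OF F_lipschitz]) auto
  have cont: "continuous_on {0..T} (\<lambda>t. F t x)" for x
    by (intro continuous_on_F continuous_intros) auto
  obtain L where L: "\<And>t. t \<in> {0..T} \<Longrightarrow> L-lipschitz_on K (F t)"
    using local_lipschitz_compact_implies_lipschitz[OF ll assms compact_Icc cont] by blast
  have "L-lipschitz_on K (F t)" if "t \<ge> 0" for t
  proof -
    obtain r where "r \<in> {0..T}" "F t = F r" using F_value_in_period \<open>t \<ge> 0\<close> by blast
    then show ?thesis using L[of r] by simp
  qed
  then show ?thesis by (rule that)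
qed

lemma integrable_F: "0 \<le> a \<Longrightarrow> (\<lambda>t. F t x) integrable_on {a..b}"
  by (intro integrable_continuous_real continuous_on_F continuous_intros) auto

text \<open>An average of functions with a common Lipschitz constant keeps that constant.\<close>

lemma time_average_lipschitz_on:
  assumes L: "\<And>t. t \<ge> 0 \<Longrightarrow> L-lipschitz_on K (F t)"
  shows "L-lipschitz_on K (time_average T F)"
proof (rule lipschitz_onI)
  show "L \<ge> 0" using L[of 0] by (auto intro: lipschitz_on_nonneg)
  fix x y assume xy: "x \<in> K" "y \<in> K"
  have "norm (integral {0..T} (\<lambda>t. F t x - F t y)) \<le> L * dist x y * (T - 0)"
  proof (rule integral_bound)
    show "continuous_on {0..T} (\<lambda>t. F t x - F t y)"
      by (intro continuous_on_F continuous_intros) auto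
    show "norm (F t x - F t y) \<le> L * dist x y" if "t \<in> {0..T}" for t
      using lipschitz_onD[OF L xy, of t] that by (simp add: dist_norm)
  qed (use T_pos in simp)
  then have "norm (integral {0..T} (\<lambda>t. F t x) - integral {0..T} (\<lambda>t. F t y)) \<le> L * dist x y * T"
    by (simp add: integral_diff integrable_F)
  then have "1 / T * norm (integral {0..T} (\<lambda>t. F t x) - integral {0..T} (\<lambda>t. F t y)) \<le> L * dist x y"
    using T_pos by (simp add: pos_divide_le_eq)
  moreover have "dist (time_average T F x) (time_average T F y)
      = 1 / T * norm (integral {0..T} (\<lambda>t. F t x) - integral {0..T} (\<lambda>t. F t y))"
    using T_pos unfolding time_average_def dist_norm scaleR_diff_right[symmetric] norm_scaleR by simp
  ultimately show "dist (time_average T F x) (time_average T F y) \<le> L * dist x y" by simp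
qed

lemma continuous_on_time_average: "continuous_on UNIV (time_average T F)"
proof -
  have "continuous_on UNIV (\<lambda>x. integral (cbox 0 T) (\<lambda>t. F t x))"
    by (rule integral_continuous_on_param) (auto simp: case_prod_beta intro!: continuous_on_F continuous_intros)
  then show ?thesis unfolding time_average_def by (auto intro!: continuous_intros)
qed

text \<open>The forcing \<open>s \<mapsto> F (s / l)\<close> has period \<open>l * T\<close> and the same average as \<open>F\<close>.\<close>

lemma fast_oscillation_mean_zero:
  assumes l: "l > 0" and a: "a \<ge> 0"
  shows "integral {a..a + l * T} (\<lambda>s. F (s / l) x - time_average T F x) = 0"
proof -
  have per: "integral {a / l..a / l + T} (\<lambda>t. F t x) = integral {0..T} (\<lambda>t. F t x)"
    using l a T_pos F_periodic by (intro integral_periodic_interval continuous_on_F continuous_intros) auto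
  have "((\<lambda>t. F t x) has_integral T *\<^sub>R time_average T F x) {a / l..a / l + T}"
    using integrable_integral[OF integrable_F, of "a / l" x "a / l + T"] l a T_pos
    unfolding per time_average_def by simp
  then have "((\<lambda>s. F (1 / l * s) x) has_integral (1 / \<bar>1 / l\<bar>) *\<^sub>R T *\<^sub>R time_average T F x)
      ((\<lambda>s. s / (1 / l)) ` {a / l..a / l + T})"
    using l by (intro has_integral_stretch_real) auto
  moreover have "(\<lambda>s. s / (1 / l)) ` {a / l..a / l + T} = {a..a + l * T}"
    using l image_mult_atLeastAtMost[of l "a / l" "a / l + T"]
    by (simp add: distrib_left mult.commute[of _ l])
  ultimately have "((\<lambda>s. F (s / l) x) has_integral (l * T) *\<^sub>R time_average T F x) {a..a + l * T}"
    using l by simp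
  then have "((\<lambda>s. F (s / l) x - time_average T F x) has_integral
      ((l * T) *\<^sub>R time_average T F x - (a + l * T - a) *\<^sub>R time_average T F x)) {a..a + l * T}"
    using l T_pos a by (intro has_integral_diff has_integral_const_real[THEN has_integral_eq_rhs]) auto
  then show ?thesis by (simp add: integral_unique)
qed

end

section \<open>The averaging principle\<close>

locale averaging = strongly_continuous_semigroup S + periodic_forcing T F
  for S :: "real \<Rightarrow> 'a::banach \<Rightarrow>\<^sub>L 'a" and T :: real and F :: "real \<Rightarrow> 'a \<Rightarrow> 'a" +
  fixes u :: "'a \<Rightarrow> real \<Rightarrow> real \<Rightarrow> 'a"
  assumes u_solution: "\<And>x l. l > 0 \<Longrightarrow> mild_solution S (\<lambda>t. F (t / l)) (u x l) \<and> u x l 0 = x"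
    and u_compact: "\<And>Q t. compact Q \<Longrightarrow> t > 0 \<Longrightarrow>
                      compact (closure {u x l t | x l. x \<in> Q \<and> l > 0})"
begin

lemma continuous_on_u: "l > 0 \<Longrightarrow> continuous_on {0..} (u x l)"
  using u_solution[of l x] by (simp add: mild_solution_def)

lemma continuous_on_forcing:
  "l > 0 \<Longrightarrow> continuous_on {0..} (\<lambda>s. F (s / l) (u x l s))"
  by (intro continuous_on_F continuous_on_u continuous_intros) auto

lemma u_eq_duhamel:
  assumes "l > 0" "t \<ge> 0"
  shows "u x l t = S t x + duhamel (\<lambda>s. F (s / l) (u x l s)) t"
  using mild_solution_iff_duhamel[of "u x l" "\<lambda>s. F (s / l)", OF continuous_on_u continuous_on_forcing]
    u_solution[OF assms(1), of x] assms by simp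

text \<open>Sublinear growth bounds the solutions by Gronwall's inequality, uniformly in \<open>l\<close> and in initial
  values from a bounded set, hence also the forcing along them.\<close>

lemma forcing_bounded:
  fixes b R :: real
  obtains C where
    "\<And>(x :: 'a) l t. norm x \<le> b \<Longrightarrow> l > 0 \<Longrightarrow> t \<in> {0..R} \<Longrightarrow> norm (F (t / l) (u x l t)) \<le> C"
proof -
  obtain M where M: "M \<ge> 1" "\<And>t. t \<in> {0..R} \<Longrightarrow> norm (S t) \<le> M"
    using norm_S_bounded by blast
  obtain c where c: "c > 0" "\<And>t x. t \<ge> 0 \<Longrightarrow> norm (F t x) \<le> c * (1 + norm x)"
    using F_growth unfolding sublinear_growth_def by blast
  define B where "B = (1 + M * \<bar>b\<bar>) * exp (M * c * \<bar>R\<bar>)"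
  show ?thesis
  proof (rule that[of "c * B"])
    fix x :: 'a and l t assume x: "norm x \<le> b" and l: "(l::real) > 0" and t: "t \<in> {0..R}"
    have "1 + norm (u x l t) \<le> (1 + M * \<bar>b\<bar>) * exp (M * c * t)"
    proof (rule Gronwall_inequality[where f = "\<lambda>t. 1 + norm (u x l t)", OF _ _ _ t])
      show "continuous_on {0..R} (\<lambda>t. 1 + norm (u x l t))"
        by (intro continuous_intros continuous_on_subset[OF continuous_on_u[OF l]]) auto
      show "M * c \<ge> 0" using M c by simp
      fix t assume t: "t \<in> {0..R}"
      have "norm (duhamel (\<lambda>s. F (s / l) (u x l s)) t) \<le> integral {0..t} (\<lambda>s. M * c * (1 + norm (u x l s)))"
        unfolding duhamel_def
      proof (rule integral_norm_bound_integral)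
        show "(\<lambda>s. S (t - s) (F (s / l) (u x l s))) integrable_on {0..t}"
          by (intro integrable_duhamel_integrand continuous_on_subset[OF continuous_on_forcing[OF l]]) auto
        show "(\<lambda>s. M * c * (1 + norm (u x l s))) integrable_on {0..t}"
          by (intro integrable_continuous_real continuous_intros
              continuous_on_subset[OF continuous_on_u[OF l]]) auto
        fix s assume s: "s \<in> {0..t}"
        have "norm (S (t - s) (F (s / l) (u x l s))) \<le> M * (c * (1 + norm (u x l s)))"
          using s t c(1) l by (intro norm_S_apply_le M c) auto
        then show "norm (S (t - s) (F (s / l) (u x l s))) \<le> M * c * (1 + norm (u x l s))"
          by (simp add: mult.assoc)
      qed
      also have "\<dots> = M * c * integral {0..t} (\<lambda>s. 1 + norm (u x l s))" by simp
      finally have D: "norm (duhamel (\<lambda>s. F (s / l) (u x l s)) t)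
        \<le> M * c * integral {0..t} (\<lambda>s. 1 + norm (u x l s))" .
      have "norm (S t x) \<le> M * \<bar>b\<bar>"
        using t x by (intro norm_S_apply_le M) auto
      then have "norm (u x l t) \<le> M * \<bar>b\<bar> + M * c * integral {0..t} (\<lambda>s. 1 + norm (u x l s))"
        using D t l by (subst u_eq_duhamel) (auto intro: norm_triangle_mono)
      then show "1 + norm (u x l t) \<le> 1 + M * \<bar>b\<bar> + M * c * integral {0..t} (\<lambda>s. 1 + norm (u x l s))"
        by simp
    qed
    also have "\<dots> \<le> B"
      unfolding B_def using M c t by (intro mult_left_mono) auto
    finally have "c * (1 + norm (u x l t)) \<le> c * B" using c by simp
    then show "norm (F (t / l) (u x l t)) \<le> c * B"
      using c(2)[of "t / l" "u x l t"] t l by simp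
  qed
qed

text \<open>Along converging parameters the solutions stay in one compact set and solve the averaged
  equation with initial value \<open>x\<close> up to an error that tends to \<open>0\<close>. The error has two parts: the shift
  \<open>v n - x\<close> of the initial value, and the Duhamel integral of the mean-zero forcing
  \<open>G t k = F t k - Fhat k\<close>, where \<open>Fhat\<close> is the time average.\<close>

lemma solutions_along_sequence:
  assumes v: "v \<longlonglongrightarrow> x" and l: "l \<longlonglongrightarrow> 0" and l_pos: "\<And>n. l n > 0"
  shows "\<exists>K. compact K \<and> (\<forall>n. \<forall>t\<in>{0..R}. u (v n) (l n) t \<in> K) \<and>
    (\<forall>e>0. \<forall>\<^sub>F n in sequentially. \<forall>t\<in>{0..R}.
      norm (u (v n) (l n) t - S t x - duhamel (\<lambda>s. time_average T F (u (v n) (l n) s)) t) \<le> e)"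
proof -
  let ?U = "\<lambda>n. u (v n) (l n)" and ?g = "\<lambda>n s. F (s / l n) (u (v n) (l n) s)"
  let ?A = "time_average T F"
  define Q where "Q = insert x (range v)"
  have Q: "compact Q" unfolding Q_def using v by (rule compact_insert_limit)
  obtain b where b: "\<And>y. y \<in> Q \<Longrightarrow> norm y \<le> b"
    using compact_imp_bounded[OF Q] unfolding bounded_iff by blast
  have vQ: "v n \<in> Q" for n by (simp add: Q_def)
  obtain C where "\<And>x l t. norm x \<le> b \<Longrightarrow> l > 0 \<Longrightarrow> t \<in> {0..R} \<Longrightarrow> norm (F (t / l) (u x l t)) \<le> C"
    using forcing_bounded[of b R] by blast
  then have C: "norm (?g n s) \<le> C" if "s \<in> {0..R}" for n s
    using that l_pos[of n] b[OF vQ[of n]] by blast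
  have g: "continuous_on {0..R} (?g n)" for n
    by (rule continuous_on_subset[OF continuous_on_forcing[OF l_pos]]) auto
  have U: "?U n t = S t (v n) + duhamel (?g n) t" if "t \<in> {0..R}" for n t
    using that by (intro u_eq_duhamel l_pos) auto
  have cont_U: "continuous_on {0..R} (?U n)" for n
    by (rule continuous_on_subset[OF continuous_on_u[OF l_pos]]) auto
  have Kt: "\<exists>K. compact K \<and> (\<forall>n\<in>UNIV. ?U n t \<in> K)" if "t \<in> {0..R}" for t
  proof (cases "t = 0")
    case True
    then have "?U n t = v n" for n using u_solution[OF l_pos[of n], of "v n"] by simp
    then show ?thesis using Q vQ by auto
  next
    case False
    let ?X = "{u x l t | x l. x \<in> Q \<and> l > 0}"
    have "?U n t \<in> closure ?X" for n
      using vQ l_pos by (intro subsetD[OF closure_subset]) blast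
    then show ?thesis using u_compact[OF Q, of t] False that by auto
  qed
  have "\<exists>K. compact K \<and> (\<forall>n\<in>UNIV. \<forall>t\<in>{0..R}. ?U n t \<in> K)"
    by (rule orbits_in_compact[where g = ?g and C = C and x = v, OF g C U Kt])
  then obtain K where K: "compact K" and UK: "\<And>n t. t \<in> {0..R} \<Longrightarrow> ?U n t \<in> K"
    by blast
  show ?thesis
  proof (intro exI[of _ K] conjI K allI impI ballI UK)
    fix e :: real assume e: "e > 0"
    obtain M where M: "M \<ge> 1" "\<And>t. t \<in> {0..R} \<Longrightarrow> norm (S t) \<le> M"
      using norm_S_bounded by blast
    obtain L where L: "\<And>t. t \<ge> 0 \<Longrightarrow> L-lipschitz_on K (F t)"
      using F_lipschitz_on_compact[OF K] by blast
    have L0: "L \<ge> 0" using L[of 0] by (auto intro: lipschitz_on_nonneg)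
    define G where "G t k = F t k - ?A k" for t k
    \<comment> \<open>All values of the mean-zero forcing on \<open>K\<close>. By periodicity the times in \<open>{0..T}\<close> suffice, which
      makes the set compact.\<close>
    define \<Gamma> where "\<Gamma> = (\<lambda>(t, k). G t k) ` ({0..T} \<times> K)"
    have cont_G: "continuous_on X (\<lambda>s. G (p s) (y s))"
      if "continuous_on X p" "continuous_on X y" "\<And>s. s \<in> X \<Longrightarrow> p s \<ge> 0" for X :: "'s::topological_space set" and p y
      unfolding G_def
      by (intro continuous_intros continuous_on_F that continuous_on_compose2[OF continuous_on_time_average]) auto
    have \<Gamma>: "compact \<Gamma>"
      unfolding \<Gamma>_def case_prod_beta
      by (intro compact_continuous_image cont_G continuous_intros compact_Times K compact_Icc) auto
    have G\<Gamma>: "G t k \<in> \<Gamma>" if t: "t \<ge> 0" and k: "k \<in> K" for t k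
    proof -
      obtain r where r: "r \<in> {0..T}" "F t = F r" using F_value_in_period[OF t] by blast
      then show ?thesis using k unfolding \<Gamma>_def G_def by auto
    qed
    obtain C' where C': "\<And>y. y \<in> \<Gamma> \<Longrightarrow> norm y \<le> C'"
      using compact_imp_bounded[OF \<Gamma>] unfolding bounded_iff by blast
    have G_lip: "(2 * L)-lipschitz_on K (G t)" if "t \<ge> 0" for t
      unfolding G_def using lipschitz_on_diff[OF L[OF that] time_average_lipschitz_on[OF L]] by simp
    \<comment> \<open>\<open>A\<close> is chosen such that the error terms, each a multiple of \<open>\<eta>\<close>, add up to \<open>\<eta> * A = e\<close>.\<close>
    define A where "A = M * (1 + (\<bar>R\<bar> * (2 * L + 1) + \<bar>C'\<bar>))"
    have A: "A > 0"
      unfolding A_def using M L0 by (intro mult_pos_pos add_pos_nonneg) auto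
    define \<eta> where "\<eta> = e / A"
    have \<eta>: "\<eta> > 0" using e A by (simp add: \<eta>_def)
    obtain d1 where d1: "d1 > 0"
      "\<And>h k. 0 \<le> h \<Longrightarrow> h \<le> d1 \<Longrightarrow> k \<in> \<Gamma> \<Longrightarrow> norm (S h k - k) \<le> \<eta>"
      using S_near_identity_on_compact[OF \<Gamma> \<eta>] by blast
    have "\<exists>d>0. \<forall>n\<in>UNIV. \<forall>r t. 0 \<le> r \<and> r \<le> t \<and> t \<le> R \<and> t - r \<le> d \<longrightarrow> norm (?U n t - ?U n r) \<le> \<eta>"
      by (rule orbits_equicontinuous[where g = ?g and C = C and x = v, OF g C U K UK \<eta>])
    then obtain d2 where d2: "d2 > 0"
      "\<And>n r t. 0 \<le> r \<Longrightarrow> r \<le> t \<Longrightarrow> t \<le> R \<Longrightarrow> t - r \<le> d2 \<Longrightarrow> norm (?U n t - ?U n r) \<le> \<eta>"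
      by blast
    define \<delta> where "\<delta> = min \<eta> (min d1 d2)"
    have \<delta>: "\<delta> > 0" using \<eta> d1 d2 by (simp add: \<delta>_def)
    have "\<forall>\<^sub>F n in sequentially. l n < \<delta> / T"
      using l \<delta> T_pos by (intro order_tendstoD) auto
    moreover have "\<forall>\<^sub>F n in sequentially. dist (v n) x < \<eta>"
      using v \<eta> by (rule tendstoD)
    ultimately show "\<forall>\<^sub>F n in sequentially. \<forall>t\<in>{0..R}.
      norm (?U n t - S t x - duhamel (\<lambda>s. ?A (?U n s)) t) \<le> e"
    proof eventually_elim
      case (elim n)
      \<comment> \<open>The period of the rescaled forcing \<open>F (s / l n)\<close>.\<close>
      define h where "h = l n * T"
      have h: "h > 0" "h \<le> \<delta>"
        using l_pos[of n] T_pos elim(1) by (auto simp: h_def field_simps)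
      show ?case
      proof
        fix t assume t: "t \<in> {0..R}"
        have "norm (duhamel (\<lambda>s. G (s / l n) (?U n s)) t) \<le> t * (M * (2 * L * \<eta> + \<eta>)) + M * C' * h"
        proof (rule duhamel_mean_zero_forcing_bound[where R = R and K = K and G = "\<lambda>s. G (s / l n)"])
          show "continuous_on ({0..} \<times> K) (\<lambda>(s, k). G (s / l n) k)"
            unfolding case_prod_beta using l_pos[of n] by (intro cont_G continuous_intros) auto
          show "(2 * L)-lipschitz_on K (G (s / l n))" if "s \<ge> 0" for s
            using that l_pos[of n] by (intro G_lip) auto
          show "norm (G (s / l n) k) \<le> C'" if "s \<ge> 0" "k \<in> K" for s k
            using that l_pos[of n] by (intro C' G\<Gamma>) auto
          show "integral {a..a + h} (\<lambda>s. G (s / l n) k) = 0" if "a \<ge> 0" for a k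
            unfolding G_def h_def by (rule fast_oscillation_mean_zero[OF l_pos that])
          show "norm (S r (G (s / l n) k) - G (s / l n) k) \<le> \<eta>"
            if "0 \<le> r" "r \<le> h" "s \<ge> 0" "k \<in> K" for r s k
            using that l_pos[of n] h by (intro d1 G\<Gamma>) (auto simp: \<delta>_def)
          show "norm (?U n s - ?U n r) \<le> \<eta>" if "0 \<le> r" "r \<le> s" "s \<le> R" "s - r \<le> h" for r s
            using that h by (intro d2(2)) (auto simp: \<delta>_def)
        qed (use M h UK cont_U t in auto)
        also have "\<dots> \<le> \<bar>R\<bar> * (M * (2 * L * \<eta> + \<eta>)) + M * \<bar>C'\<bar> * \<eta>"
        proof (rule add_mono)
          show "t * (M * (2 * L * \<eta> + \<eta>)) \<le> \<bar>R\<bar> * (M * (2 * L * \<eta> + \<eta>))"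
            using t M L0 \<eta> by (intro mult_right_mono) auto
          have "M * C' \<le> M * \<bar>C'\<bar>" using M by (intro mult_left_mono) auto
          then show "M * C' * h \<le> M * \<bar>C'\<bar> * \<eta>"
            by (rule mult_mono) (use M h in \<open>auto simp: \<delta>_def\<close>)
        qed
        finally have 1: "norm (duhamel (\<lambda>s. G (s / l n) (?U n s)) t)
          \<le> \<bar>R\<bar> * (M * (2 * L * \<eta> + \<eta>)) + M * \<bar>C'\<bar> * \<eta>" .
        have 2: "norm (S t (v n - x)) \<le> M * \<eta>"
          using t elim(2) \<eta> by (intro norm_S_apply_le M) (auto simp: dist_norm)
        have sub: "{0..t} \<subseteq> {0..R}" using t by auto
        have "duhamel (\<lambda>s. G (s / l n) (?U n s)) t = duhamel (?g n) t - duhamel (\<lambda>s. ?A (?U n s)) t"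
          unfolding duhamel_def G_def blinfun.diff_right
          by (intro integral_diff integrable_duhamel_integrand continuous_on_subset[OF g sub]
              continuous_on_compose2[OF continuous_on_time_average continuous_on_subset[OF cont_U sub]]) auto
        then have "?U n t - S t x - duhamel (\<lambda>s. ?A (?U n s)) t
            = S t (v n - x) + duhamel (\<lambda>s. G (s / l n) (?U n s)) t"
          using U[OF t, of n] by (simp add: blinfun.diff_right)
        also have "norm \<dots> \<le> M * \<eta> + (\<bar>R\<bar> * (M * (2 * L * \<eta> + \<eta>)) + M * \<bar>C'\<bar> * \<eta>)"
          by (rule norm_triangle_mono[OF 2 1])
        also have "\<dots> = \<eta> * A" by (simp add: A_def algebra_simps)
        also have "\<dots> = e" using A by (simp add: \<eta>_def)
        finally show "norm (?U n t - S t x - duhamel (\<lambda>s. ?A (?U n s)) t) \<le> e" .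
      qed
    qed
  qed
qed

text \<open>The averaged equation is solved by the limit of the solutions with initial value \<open>x\<close> and
  \<open>l = 1 / (n + 1)\<close>, which form a uniform Cauchy sequence on every \<open>{0..R}\<close>.\<close>

lemma averaged_limit_exists:
  "\<exists>w. continuous_on {0..} w \<and> (\<forall>t\<ge>0. w t = S t x + duhamel (\<lambda>s. time_average T F (w s)) t)"
proof -
  let ?A = "time_average T F"
  define y where "y n = u x (1 / (real n + 1))" for n :: nat
  define w where "w t = lim (\<lambda>n. y n t)" for t
  have pos: "1 / (real n + 1) > 0" for n by simp
  have lim0: "(\<lambda>n. 1 / (real n + 1)) \<longlonglongrightarrow> 0"
    using LIMSEQ_inverse_real_of_nat by (simp add: inverse_eq_divide add.commute)
  have cont_y: "continuous_on {0..R} (y n)" for R n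
    unfolding y_def by (rule continuous_on_subset[OF continuous_on_u[OF pos]]) auto
  have *: "continuous_on {0..R} w \<and> (\<forall>t\<in>{0..R}. w t = S t x + duhamel (\<lambda>s. ?A (w s)) t)" for R
  proof -
    obtain K where K: "compact K" and yK: "\<And>n t. t \<in> {0..R} \<Longrightarrow> y n t \<in> K"
      and err: "\<And>e. e > 0 \<Longrightarrow> \<forall>\<^sub>F n in sequentially. \<forall>t\<in>{0..R}.
        norm (y n t - S t x - duhamel (\<lambda>s. ?A (y n s)) t) \<le> e"
      using solutions_along_sequence[OF tendsto_const[of x] lim0 pos, of R] unfolding y_def by blast
    obtain M where M: "M \<ge> 1" "\<And>t. t \<in> {0..R} \<Longrightarrow> norm (S t) \<le> M"
      using norm_S_bounded by blast
    obtain L where L: "\<And>t. t \<ge> 0 \<Longrightarrow> L-lipschitz_on K (F t)"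
      using F_lipschitz_on_compact[OF K] by blast
    note A_lip = time_average_lipschitz_on[OF L]
    have L0: "L \<ge> 0" using A_lip by (rule lipschitz_on_nonneg)
    have "uniformly_Cauchy_on {0..R} y"
    proof (rule uniformly_Cauchy_onI)
      fix e :: real assume e: "e > 0"
      define a where "a = e / (3 * exp (M * L * \<bar>R\<bar>))"
      have a: "a > 0" using e by (simp add: a_def)
      obtain N where N: "\<And>n t. n \<ge> N \<Longrightarrow> t \<in> {0..R} \<Longrightarrow>
          norm (y n t - S t x - duhamel (\<lambda>s. ?A (y n s)) t) \<le> a"
        using err[OF a] unfolding eventually_sequentially by blast
      have "dist (y m t) (y n t) < e" if "t \<in> {0..R}" "m \<ge> N" "n \<ge> N" for t m n
      proof -
        have "norm (y m t - y n t) \<le> (a + a) * exp (M * L * t)"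
          using M that
          by (intro approximate_mild_solutions_close[OF cont_y yK cont_y yK A_lip M(2) _ N N]) auto
        also have "\<dots> \<le> (a + a) * exp (M * L * \<bar>R\<bar>)"
          using a M L0 that by (intro mult_left_mono) (auto intro!: mult_left_mono)
        also have "\<dots> < e" using e by (simp add: a_def)
        finally show ?thesis by (simp add: dist_norm)
      qed
      then show "\<exists>N. \<forall>t\<in>{0..R}. \<forall>m\<ge>N. \<forall>n\<ge>N. dist (y m t) (y n t) < e" by blast
    qed
    then have lim: "uniform_limit {0..R} y w sequentially"
      unfolding w_def using Cauchy_uniformly_convergent uniformly_convergent_uniform_limit_iff by blast
    have cont_w: "continuous_on {0..R} w"
      using cont_y by (intro uniform_limit_theorem[OF _ lim]) auto
    have wK: "w t \<in> K" if "t \<in> {0..R}" for t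
      by (rule Lim_in_closed_set[OF compact_imp_closed[OF K] _ _ tendsto_uniform_limitI[OF lim that]])
        (simp_all add: yK[OF that])
    have "w t = S t x + duhamel (\<lambda>s. ?A (w s)) t" if t: "t \<in> {0..R}" for t
    proof -
      have sub: "{0..t} \<subseteq> {0..R}" using t by auto
      have "norm (w t - S t x - duhamel (\<lambda>s. ?A (w s)) t) \<le> 0"
      proof (rule field_le_epsilon)
        fix e :: real assume e: "e > 0"
        \<comment> \<open>The equation for \<open>y n\<close> and the distance of \<open>y n\<close> from \<open>w\<close> each cost \<open>d\<close>, and replacing \<open>y n\<close> by \<open>w\<close>
          under the integral costs \<open>M * L * R * d\<close>.\<close>
        define b where "b = 2 + M * L * \<bar>R\<bar>"
        have b: "b > 0" using M L0 by (simp add: b_def add_pos_nonneg)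
        define d where "d = e / b"
        have d: "d > 0" using e b by (simp add: d_def)
        have "\<forall>\<^sub>F n in sequentially. \<forall>s\<in>{0..R}. dist (y n s) (w s) < d"
          using lim d by (auto simp: uniform_limit_iff)
        with err[OF d] have "\<forall>\<^sub>F n in sequentially. (\<forall>s\<in>{0..R}. dist (y n s) (w s) < d) \<and>
            (\<forall>t\<in>{0..R}. norm (y n t - S t x - duhamel (\<lambda>s. ?A (y n s)) t) \<le> d)"
          by eventually_elim blast
        then obtain n where n: "\<And>s. s \<in> {0..R} \<Longrightarrow> norm (y n s - w s) \<le> d"
          "\<And>t. t \<in> {0..R} \<Longrightarrow> norm (y n t - S t x - duhamel (\<lambda>s. ?A (y n s)) t) \<le> d"
          unfolding eventually_sequentially dist_norm by (meson less_imp_le order_refl)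
        have "norm (duhamel (\<lambda>s. ?A (y n s)) t - duhamel (\<lambda>s. ?A (w s)) t)
            \<le> M * L * integral {0..t} (\<lambda>s. norm (y n s - w s))"
          using t M by (intro norm_duhamel_diff_le[OF continuous_on_subset[OF cont_y sub] yK
              continuous_on_subset[OF cont_w sub] wK A_lip]) auto
        also have "integral {0..t} (\<lambda>s. norm (y n s - w s)) \<le> integral {0..t} (\<lambda>s. d)"
          using t by (intro integral_le integrable_continuous_real continuous_intros n
              continuous_on_subset[OF cont_y sub] continuous_on_subset[OF cont_w sub]) auto
        also have "\<dots> \<le> \<bar>R\<bar> * d" using t d by simp
        finally have 1: "norm (duhamel (\<lambda>s. ?A (y n s)) t - duhamel (\<lambda>s. ?A (w s)) t) \<le> M * L * (\<bar>R\<bar> * d)"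
          using M L0 by (simp add: mult_left_mono)
        have "w t - S t x - duhamel (\<lambda>s. ?A (w s)) t
            = ((y n t - S t x - duhamel (\<lambda>s. ?A (y n s)) t) - (y n t - w t))
              + (duhamel (\<lambda>s. ?A (y n s)) t - duhamel (\<lambda>s. ?A (w s)) t)" by simp
        also have "norm \<dots> \<le> (d + d) + M * L * (\<bar>R\<bar> * d)"
          by (intro norm_triangle_mono 1 order_trans[OF norm_triangle_ineq4] add_mono n t)
        also have "\<dots> = d * b" by (simp add: b_def algebra_simps)
        also have "\<dots> = 0 + e" using b by (simp add: d_def)
        finally show "norm (w t - S t x - duhamel (\<lambda>s. ?A (w s)) t) \<le> 0 + e" .
      qed
      then show ?thesis by (simp add: algebra_simps)
    qed
    then show ?thesis using cont_w by blast
  qed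
  have "continuous (at t within {0..}) w" if t: "t \<in> {0..}" for t
  proof -
    have "continuous (at t within {0..t + 1}) w"
      using *[of "t + 1"] t by (simp add: continuous_on_eq_continuous_within)
    moreover have "at t within {0..t + 1} = at t within {0..}"
      by (rule at_within_nhd[of t "{..<t + 1}"]) auto
    ultimately show ?thesis by simp
  qed
  then have "continuous_on {0..} w"
    by (simp add: continuous_on_eq_continuous_within)
  moreover have "w t = S t x + duhamel (\<lambda>s. ?A (w s)) t" if "t \<ge> 0" for t
    by (rule *[of t, THEN conjunct2, THEN bspec]) (use that in auto)
  ultimately show ?thesis by blast
qed

lemma averaged_solution_unique:
  assumes w: "continuous_on {0..} w" "\<And>t. t \<ge> 0 \<Longrightarrow> w t = S t x + duhamel (\<lambda>s. time_average T F (w s)) t"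
    and w': "continuous_on {0..} w'" "\<And>t. t \<ge> 0 \<Longrightarrow> w' t = S t x + duhamel (\<lambda>s. time_average T F (w' s)) t"
    and t: "t \<ge> 0"
  shows "w' t = w t"
proof -
  have cont: "continuous_on {0..t} w" "continuous_on {0..t} w'"
    by (auto intro: continuous_on_subset[OF w(1)] continuous_on_subset[OF w'(1)])
  define K where "K = w ` {0..t} \<union> w' ` {0..t}"
  have K: "compact K" unfolding K_def by (intro compact_Un compact_continuous_image cont compact_Icc)
  obtain M where M: "M \<ge> 1" "\<And>s. s \<in> {0..t} \<Longrightarrow> norm (S s) \<le> M"
    using norm_S_bounded by blast
  obtain L where L: "\<And>t. t \<ge> 0 \<Longrightarrow> L-lipschitz_on K (F t)"
    using F_lipschitz_on_compact[OF K] by blast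
  have "norm (w' t - w t) \<le> (0 + 0) * exp (M * L * t)"
    using M t w(2) w'(2)
    by (intro approximate_mild_solutions_close[OF cont(2) _ cont(1) _ time_average_lipschitz_on[OF L] M(2)])
      (auto simp: K_def)
  then show ?thesis by simp
qed

text \<open>The exact solution \<open>w\<close> may leave the compact set of the approximating solutions, so the
  stability estimate is applied in the union of that set with the orbit of \<open>w\<close>.\<close>

lemma uniform_limit_along_sequence:
  assumes w: "continuous_on {0..} w" "\<And>t. t \<ge> 0 \<Longrightarrow> w t = S t x + duhamel (\<lambda>s. time_average T F (w s)) t"
    and v: "v \<longlonglongrightarrow> x" and l: "l \<longlonglongrightarrow> 0" and l_pos: "\<And>n. l n > 0"
  shows "uniform_limit {0..R} (\<lambda>n. u (v n) (l n)) w sequentially"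
  unfolding uniform_limit_iff
proof (intro allI impI)
  fix e :: real assume e: "e > 0"
  let ?A = "time_average T F"
  obtain K where K: "compact K" and uK: "\<And>n t. t \<in> {0..R} \<Longrightarrow> u (v n) (l n) t \<in> K"
    and err: "\<And>e. e > 0 \<Longrightarrow> \<forall>\<^sub>F n in sequentially. \<forall>t\<in>{0..R}.
      norm (u (v n) (l n) t - S t x - duhamel (\<lambda>s. ?A (u (v n) (l n) s)) t) \<le> e"
    using solutions_along_sequence[OF v l l_pos, of R] by blast
  have cont_w: "continuous_on {0..R} w" by (rule continuous_on_subset[OF w(1)]) auto
  have cont_u: "continuous_on {0..R} (u (v n) (l n))" for n
    by (rule continuous_on_subset[OF continuous_on_u[OF l_pos]]) auto
  define K' where "K' = K \<union> w ` {0..R}"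
  have K': "compact K'" unfolding K'_def by (intro compact_Un K compact_continuous_image cont_w compact_Icc)
  have uK': "u (v n) (l n) t \<in> K'" if "t \<in> {0..R}" for n t using uK[OF that] by (simp add: K'_def)
  have wK': "w t \<in> K'" if "t \<in> {0..R}" for t using that by (simp add: K'_def)
  obtain M where M: "M \<ge> 1" "\<And>t. t \<in> {0..R} \<Longrightarrow> norm (S t) \<le> M"
    using norm_S_bounded by blast
  obtain L where L: "\<And>t. t \<ge> 0 \<Longrightarrow> L-lipschitz_on K' (F t)"
    using F_lipschitz_on_compact[OF K'] by blast
  note A_lip = time_average_lipschitz_on[OF L]
  have L0: "L \<ge> 0" using A_lip by (rule lipschitz_on_nonneg)
  define a where "a = e / (2 * exp (M * L * \<bar>R\<bar>))"
  have a: "a > 0" using e by (simp add: a_def)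
  show "\<forall>\<^sub>F n in sequentially. \<forall>t\<in>{0..R}. dist (u (v n) (l n) t) (w t) < e"
    using err[OF a]
  proof eventually_elim
    case (elim n)
    show ?case
    proof
      fix t assume t: "t \<in> {0..R}"
      have w0: "norm (w s - S s x - duhamel (\<lambda>r. ?A (w r)) s) \<le> 0" if "s \<in> {0..R}" for s
        using w(2)[of s] that by simp
      have "norm (u (v n) (l n) t - w t) \<le> (a + 0) * exp (M * L * t)"
        using M t elim
        by (intro approximate_mild_solutions_close[OF cont_u uK' cont_w wK' A_lip M(2) _ _ w0]) auto
      also have "\<dots> \<le> a * exp (M * L * \<bar>R\<bar>)"
        using a M L0 t by (auto intro!: mult_left_mono)
      also have "\<dots> < e" using e by (simp add: a_def)
      finally show "dist (u (v n) (l n) t) (w t) < e" by (simp add: dist_norm)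
    qed
  qed
qed

lemma mild_solution_average_iff:
  "mild_solution S (\<lambda>t. time_average T F) w \<and> w 0 = x \<longleftrightarrow>
    continuous_on {0..} w \<and> (\<forall>t\<ge>0. w t = S t x + duhamel (\<lambda>s. time_average T F (w s)) t)"
proof (cases "continuous_on {0..} w")
  case True
  then have "continuous_on {0..} (\<lambda>s. time_average T F (w s))"
    by (rule continuous_on_compose2[OF continuous_on_time_average]) simp
  then have "mild_solution S (\<lambda>t. time_average T F) w \<longleftrightarrow>
      (\<forall>t\<ge>0. w t = S t (w 0) + duhamel (\<lambda>s. time_average T F (w s)) t)"
    by (rule mild_solution_iff_duhamel[OF True])
  moreover have "w 0 = x" if "\<forall>t\<ge>0. w t = S t x + duhamel (\<lambda>s. time_average T F (w s)) t"
    using that[rule_format, of 0] by simp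
  ultimately show ?thesis using True by blast
qed (simp add: mild_solution_def)

end

text \<open>A property that fails for parameters arbitrarily close to \<open>(x, 0)\<close> fails along a whole sequence of
  them, since both filters have countable bases.\<close>

lemma eventually_prod_nhds_at_right_sequentially:
  fixes x :: "'a::metric_space"
  assumes "\<And>v l. v \<longlonglongrightarrow> x \<Longrightarrow> l \<longlonglongrightarrow> 0 \<Longrightarrow> (\<And>n. l n > 0) \<Longrightarrow> \<exists>n :: nat. P (v n) (l n)"
  shows "\<forall>\<^sub>F (v, l) in nhds x \<times>\<^sub>F at_right (0 :: real). P v l"
proof (rule ccontr)
  assume neg: "\<not> ?thesis"
  have "\<exists>v l. dist v x < 1 / (real n + 1) \<and> 0 < l \<and> l < 1 / (real n + 1) \<and> \<not> P v l" for n
  proof (rule ccontr)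
    assume no: "\<not> ?thesis"
    have r: "1 / (real n + 1) > 0" by simp
    have "\<forall>\<^sub>F v in nhds x. dist v x < 1 / (real n + 1)"
      using r unfolding eventually_nhds_metric by blast
    moreover have "\<forall>\<^sub>F l in at_right 0. l \<in> {0<..<1 / (real n + 1)}"
      using r by (rule eventually_at_right_real)
    moreover have "\<forall>v l. dist v x < 1 / (real n + 1) \<longrightarrow> l \<in> {0<..<1 / (real n + 1)} \<longrightarrow> P v l"
      using no by simp
    ultimately have "\<forall>\<^sub>F (v, l) in nhds x \<times>\<^sub>F at_right 0. P v l"
      unfolding eventually_prod_filter by fast
    then show False using neg by simp
  qed
  then obtain v l where vl: "\<And>n. dist (v n) x < 1 / (real n + 1)" "\<And>n. 0 < l n"
      "\<And>n. l n < 1 / (real n + 1)" "\<And>n. \<not> P (v n) (l n)"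
    by metis
  have lim0: "(\<lambda>n. 1 / (real n + 1)) \<longlonglongrightarrow> 0"
    using LIMSEQ_inverse_real_of_nat by (simp add: inverse_eq_divide add.commute)
  have "l \<longlonglongrightarrow> 0"
    by (rule tendsto_sandwich[OF _ _ tendsto_const lim0]) (use vl in \<open>auto intro!: always_eventually less_imp_le\<close>)
  moreover have "v \<longlonglongrightarrow> x"
  proof (rule tendsto_dist_iff[THEN iffD2])
    show "(\<lambda>n. dist (v n) x) \<longlonglongrightarrow> 0"
      by (rule tendsto_sandwich[OF _ _ tendsto_const lim0]) (use vl in \<open>auto intro!: always_eventually less_imp_le\<close>)
  qed
  ultimately show False using assms[of v l] vl(2,4) by blast
qed

theorem theorem4p1:
  fixes S :: "real \<Rightarrow> 'a::banach \<Rightarrow>\<^sub>L 'a"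
    and D :: "'a set" and A :: "'a \<Rightarrow> 'a"
    and F :: "real \<Rightarrow> 'a \<Rightarrow> 'a"
    and T :: real
    and u :: "'a \<Rightarrow> real \<Rightarrow> real \<Rightarrow> 'a"
  assumes semigroup: "C0_semigroup S"
    and generator: "is_generator D A S"
    and T_pos: "T > 0"
    and F_continuous: "continuous_on ({0..} \<times> UNIV) (\<lambda>(t, x). F t x)"
    and F_lipschitz: "local_lipschitz {0..} UNIV F"
    and F_growth: "sublinear_growth F"
    and F_periodic: "\<And>t x. t \<ge> 0 \<Longrightarrow> F (t + T) x = F t x"
    and u_solution: "\<And>x l. l > 0 \<Longrightarrow> mild_solution S (\<lambda>t. F (t / l)) (u x l) \<and> u x l 0 = x"
    and u_compact: "\<And>Q t. compact Q \<Longrightarrow> t > 0 \<Longrightarrow>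
                      compact (closure {u x l t | x l. x \<in> Q \<and> l > 0})"
  shows "\<forall>x. \<exists>w.
           mild_solution S (\<lambda>t. time_average T F) w \<and> w 0 = x \<and>
           (\<forall>w'. mild_solution S (\<lambda>t. time_average T F) w' \<and> w' 0 = x \<longrightarrow> (\<forall>t\<ge>0. w' t = w t)) \<and>
           (\<forall>J. is_interval J \<and> bounded J \<and> J \<subseteq> {0..} \<longrightarrow>
              uniform_limit J (\<lambda>(v, l). u v l) w (nhds x \<times>\<^sub>F at_right 0))"
proof
  fix x
  interpret averaging S T F u
    using assms by unfold_locales
  obtain w where w: "continuous_on {0..} w"
      "\<forall>t\<ge>0. w t = S t x + duhamel (\<lambda>s. time_average T F (w s)) t"
    using averaged_limit_exists[of x] by blast
  then have sol: "mild_solution S (\<lambda>t. time_average T F) w \<and> w 0 = x"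
    using mild_solution_average_iff[of w x] by blast
  have unique: "w' t = w t" if "mild_solution S (\<lambda>t. time_average T F) w' \<and> w' 0 = x" "t \<ge> 0" for w' t
    using that(1) averaged_solution_unique[OF w(1) w(2)[rule_format], of w' t] that(2)
    unfolding mild_solution_average_iff by blast
  have conv: "uniform_limit J (\<lambda>(v, l). u v l) w (nhds x \<times>\<^sub>F at_right 0)"
    if J: "bounded J" "J \<subseteq> {0..}" for J
    unfolding uniform_limit_iff
  proof (intro allI impI)
    fix e :: real assume e: "e > 0"
    obtain R where "\<And>t. t \<in> J \<Longrightarrow> \<bar>t\<bar> \<le> R" using J(1) unfolding bounded_real by blast
    then have JR: "J \<subseteq> {0..R}" using J(2) by force
    have "\<forall>\<^sub>F (v, l) in nhds x \<times>\<^sub>F at_right 0. \<forall>t\<in>{0..R}. dist (u v l t) (w t) < e"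
    proof (rule eventually_prod_nhds_at_right_sequentially)
      fix v :: "nat \<Rightarrow> 'a" and l :: "nat \<Rightarrow> real"
      assume "v \<longlonglongrightarrow> x" "l \<longlonglongrightarrow> 0" "\<And>n. l n > 0"
      then have "uniform_limit {0..R} (\<lambda>n. u (v n) (l n)) w sequentially"
        using w by (intro uniform_limit_along_sequence) auto
      then have "\<forall>\<^sub>F n in sequentially. \<forall>t\<in>{0..R}. dist (u (v n) (l n) t) (w t) < e"
        using e unfolding uniform_limit_iff by blast
      then show "\<exists>n. \<forall>t\<in>{0..R}. dist (u (v n) (l n) t) (w t) < e"
        by (rule eventually_happens'[OF sequentially_bot])
    qed
    then show "\<forall>\<^sub>F p in nhds x \<times>\<^sub>F at_right 0. \<forall>t\<in>J. dist ((case p of (v, l) \<Rightarrow> u v l) t) (w t) < e"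
      by (rule eventually_mono) (use JR in auto)
  qed
  show "\<exists>w. mild_solution S (\<lambda>t. time_average T F) w \<and> w 0 = x \<and>
           (\<forall>w'. mild_solution S (\<lambda>t. time_average T F) w' \<and> w' 0 = x \<longrightarrow> (\<forall>t\<ge>0. w' t = w t)) \<and>
           (\<forall>J. is_interval J \<and> bounded J \<and> J \<subseteq> {0..} \<longrightarrow>
              uniform_limit J (\<lambda>(v, l). u v l) w (nhds x \<times>\<^sub>F at_right 0))"
    using sol unique conv by blast
qed

end
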